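(* Let $q = p^n$, where $p$ is a prime number and $n \geq 2$ is an integer, and let $1 \leq e \leq \lfloor n/2 \rfloor$ be an integer. Let $\mathcal{P}_{f_e}$ denote the number of $e$-Klenian polynomials over $\mathbb{F}_q$. Then $$\mathcal{P}_{f_e} = \begin{cases} \dfrac{(p^n)!\,(p^n-1)!}{p^{2e}\varphi(p^e)\varphi(p^{n-e})} & \text{if } e < \frac{n}{2},\\[2ex] \dfrac{(p^n)!\,(p^n-1)!}{\varphi(p^e)^2\,(p^{2e}+p^{2e-1})} & \text{if } e = \frac{n}{2} \text{ and } n \text{ is even}, \end{cases}$$ where $\varphi$ is Euler's totient function.
   Context: Let $\mathbb{F}_q = \{c_0, \ldots, c_{q-1}\}$ be a fixed listing, and let $\mathfrak{S}_q$ be the symmetric group on the set $\mathbb{F}_q$ (products are compositions). Polynomials over $\mathbb{F}_q$ are taken with degree less than $q$ in each variable, i.e. identified with functions. A polynomial $f\in\mathbb{F}_q[X_1,X_2]$ is a local permutation polynomial (LPP) if $f(a,X_2)$ and $f(X_1,a)$ are permutation polynomials of $\mathbb{F}_q$ for every $a\in\mathbb{F}_q$. LPPs correspond bijectively to permutation polynomial tuples, i.e. (ordered) tuples $\underline{\beta}_f=(\beta_0,\ldots,\beta_{q-1})\in\mathfrak{S}_q^q$ such that $\beta_i\beta_j^{-1}$ has no fixed points for $i\ne j$, via $f(x,\beta_i(x))=c_i$ for all $x\in\mathbb{F}_q$ and all $i$. If $\{\beta_0,\ldots,\beta_{q-1}\}$ is a subgroup of $\mathfrak{S}_q$, then $f$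 is called a permutation group polynomial and this subgroup is its associated group. For $0\le e<n$ put $\ell=p^e$, $t=q/\ell$, and let $G=\langle a,b\rangle=\{a^{i}b^{j}: 0\le i\le \ell-1,\ 0\le j\le t-1\}<\mathfrak{S}_q$, where $a=\prod_{i=0}^{t-1}(c_{i\ell},c_{i\ell+1},\ldots,c_{(i+1)\ell-1})$ and $b=\prod_{j=0}^{\ell-1}(c_j,c_{j+\ell},\ldots,c_{j+(t-1)\ell})$. This $G$ is a subgroup of order $q$, isomorphic to $\mathbb{Z}_{p^e}\times\mathbb{Z}_{p^{n-e}}$, in which no non-identity element has a fixed point. An $e$-Klenian polynomial over $\mathbb{F}_q$ is a permutation group polynomial of this form, i.e. one whose associated group (a subgroup of $\mathfrak{S}_q$) is isomorphic to $G$. *)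

theory Defs
  imports
    Complex_Main
    "HOL-Library.Cardinality"
    "HOL-Algebra.Bij"
    "HOL-Algebra.Generated_Groups"
    "HOL-Combinatorics.Cycles"
    "HOL-Computational_Algebra.Polynomial"
    "HOL-Number_Theory.Totient"
begin

text \<open>
  A bivariate polynomial \<open>f(X1, X2)\<close> is an element of \<open>'a poly poly\<close>, read as a polynomial in
  \<open>X2\<close> whose coefficients are polynomials in \<open>X1\<close>. The field of order \<open>q\<close> is the
  type \<open>'a\<close>, so \<open>q = CARD('a)\<close>.
\<close>

definition subst_fst :: "'a::comm_ring_1 poly poly \<Rightarrow> 'a \<Rightarrow> 'a poly" where
  "subst_fst f a = map_poly (\<lambda>g. poly g a) f"

definition subst_snd :: "'a::comm_ring_1 poly poly \<Rightarrow> 'a \<Rightarrow> 'a poly" where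
  "subst_snd f a = poly f [:a:]"

definition eval2 :: "'a::comm_ring_1 poly poly \<Rightarrow> 'a \<Rightarrow> 'a \<Rightarrow> 'a" where
  "eval2 f x y = poly (subst_fst f x) y"

lemma poly_subst_snd: "poly (subst_snd f y) x = eval2 f x y"
proof (induction f)
  case 0
  then show ?case by (simp add: subst_snd_def eval2_def subst_fst_def)
next
  case (pCons g f)
  then show ?case
    by (simp add: subst_snd_def eval2_def subst_fst_def map_poly_pCons)
qed

definition reduced_poly2 :: "'a::{field,finite} poly poly \<Rightarrow> bool" where
  "reduced_poly2 f \<longleftrightarrow> degree f < CARD('a) \<and> (\<forall>j. degree (coeff f j) < CARD('a))"

definition permutation_poly :: "'a::{field,finite} poly \<Rightarrow> bool" where
  "permutation_poly g \<longleftrightarrow> bij (poly g)"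

definition local_permutation_poly :: "'a::{field,finite} poly poly \<Rightarrow> bool" where
  "local_permutation_poly f \<longleftrightarrow> reduced_poly2 f \<and>
     (\<forall>a. permutation_poly (subst_fst f a) \<and> permutation_poly (subst_snd f a))"

text \<open>
  The listing of the field is a function \<open>c\<close> on \<open>nat\<close>, used only at the indices
  \<open>0, \<dots>, q - 1\<close>.
\<close>

definition perm_tuple :: "(nat \<Rightarrow> 'a::{field,finite}) \<Rightarrow> 'a poly poly \<Rightarrow> nat \<Rightarrow> 'a \<Rightarrow> 'a" where
  "perm_tuple c f i = (\<lambda>x. THE y. eval2 f x y = c i)"

lemma eval2_perm_tuple:
  assumes "local_permutation_poly f"
  shows "eval2 f x (perm_tuple c f i x) = c i"
proof -
  have "bij (eval2 f x)"
    using assms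
    by (simp add: local_permutation_poly_def permutation_poly_def eval2_def[abs_def])
  then have "\<exists>!y. eval2 f x y = c i"
    by (metis bij_pointE)
  then show ?thesis
    unfolding perm_tuple_def by (rule theI')
qed

definition associated_set ::
  "(nat \<Rightarrow> 'a::{field,finite}) \<Rightarrow> 'a poly poly \<Rightarrow> ('a \<Rightarrow> 'a) set" where
  "associated_set c f = perm_tuple c f ` {..<CARD('a)}"

definition permutation_group_poly ::
  "(nat \<Rightarrow> 'a::{field,finite}) \<Rightarrow> 'a poly poly \<Rightarrow> bool" where
  "permutation_group_poly c f \<longleftrightarrow>
     local_permutation_poly f \<and> subgroup (associated_set c f) (BijGroup UNIV)"

text \<open>
  In the following, \<open>l\<close> stands for \<open>p ^ e\<close> and \<open>t\<close> for \<open>q div l\<close>. The cycles in each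
  product are pairwise disjoint, so the order of composition does not matter.
\<close>

definition klenian_a :: "(nat \<Rightarrow> 'a) \<Rightarrow> nat \<Rightarrow> nat \<Rightarrow> 'a \<Rightarrow> 'a" where
  "klenian_a c l t =
     foldr (\<circ>) (map (\<lambda>i. cycle_of_list (map (\<lambda>k. c (i * l + k)) [0..<l])) [0..<t]) id"

definition klenian_b :: "(nat \<Rightarrow> 'a) \<Rightarrow> nat \<Rightarrow> nat \<Rightarrow> 'a \<Rightarrow> 'a" where
  "klenian_b c l t =
     foldr (\<circ>) (map (\<lambda>j. cycle_of_list (map (\<lambda>k. c (j + k * l)) [0..<t])) [0..<l]) id"

definition klenian_group ::
  "(nat \<Rightarrow> 'a::{field,finite}) \<Rightarrow> nat \<Rightarrow> nat \<Rightarrow> ('a \<Rightarrow> 'a) set" where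
  "klenian_group c p e =
     (let l = p ^ e; t = CARD('a) div l
      in generate (BijGroup UNIV) {klenian_a c l t, klenian_b c l t})"

definition klenian_poly ::
  "(nat \<Rightarrow> 'a::{field,finite}) \<Rightarrow> nat \<Rightarrow> nat \<Rightarrow> 'a poly poly \<Rightarrow> bool" where
  "klenian_poly c p e f \<longleftrightarrow>
     permutation_group_poly c f \<and>
     (BijGroup UNIV)\<lparr>carrier := associated_set c f\<rparr> \<cong>
       (BijGroup UNIV)\<lparr>carrier := klenian_group c p e\<rparr>"

end

theory Submission
  imports Defs "HOL-Algebra.Elementary_Groups"
begin

text \<open>
  Lagrange interpolation turns local permutation polynomials into tuples of permutations, and the
  associated set of such a polynomial is always sharply transitive. Hence an \<open>e\<close>-Klenian polynomial is an
  ordering (\<open>q!\<close> choices) of a sharply transitive subgroup \<open>K\<close> of the symmetric group with \<open>K \<cong> G\<close>,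
  where \<open>G = \<int>/l \<times> \<int>/t\<close>.

  To count these \<open>K\<close>, count regular representations \<open>\<rho>\<close> of \<open>G\<close> on the field in two ways. Fixing a
  base point \<open>x0\<close>, \<open>\<rho>\<close> amounts to the bijection \<open>g \<mapsto> \<rho> g x0\<close>, whose value at the identity is
  prescribed: \<open>(q - 1)!\<close> choices. Sorting by the image \<open>K\<close> instead, each \<open>K\<close> arises from exactly
  \<open>|Aut G|\<close> of them. So the number of \<open>e\<close>-Klenian polynomials is \<open>q! (q - 1)! / |Aut G|\<close>, and
  \<open>Aut G\<close> is counted as a set of \<open>2 \<times> 2\<close> matrices with determinant prime to \<open>p\<close>.
\<close>

section \<open>Interpolation and counting bijections\<close>

lemma ex_poly_interpolating:
  fixes g :: "'a::{field,finite} \<Rightarrow> 'a"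
  shows "\<exists>P. degree P < CARD('a) \<and> poly P = g"
proof -
  \<comment> \<open>The Lagrange basis polynomial at \<open>a\<close>: a product over the q - 1
    other points, scaled to take the value 1 at \<open>a\<close>.\<close>
  define D where "D a = smult (inverse (\<Prod>b\<in>-{a}. a - b)) (\<Prod>b\<in>-{a}. [:-b, 1:])" for a :: 'a
  have deg: "degree (D a) < CARD('a)" for a
  proof -
    have "degree (D a) \<le> degree (\<Prod>b\<in>-{a}. [:-b, 1:])"
      unfolding D_def by (rule degree_smult_le)
    also have "\<dots> \<le> (\<Sum>b\<in>-{a}. 1)"
      using degree_prod_sum_le[of "-{a}" "\<lambda>b. [:-b, 1:]"] by simp
    also have "\<dots> < CARD('a)"
      by (simp add: Compl_eq_Diff_UNIV card_Diff_singleton finite_UNIV_card_ge_0)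
    finally show ?thesis .
  qed
  have val: "poly (D a) x = (if x = a then 1 else 0)" for a x
    by (auto simp: D_def poly_prod)
  have "degree (\<Sum>a\<in>UNIV. smult (g a) (D a)) < CARD('a)"
    by (rule degree_sum_less) (use deg degree_smult_le le_less_trans in \<open>auto simp: finite_UNIV_card_ge_0\<close>)
  moreover have "poly (\<Sum>a\<in>UNIV. smult (g a) (D a)) x = g x" for x
    by (simp add: poly_sum val if_distrib[of "\<lambda>y. _ * y"] cong: if_cong)
  ultimately show ?thesis by blast
qed

lemma reduced_poly_eqI:
  fixes P Q :: "'a::{field,finite} poly"
  assumes "degree P < CARD('a)" "degree Q < CARD('a)" "poly P = poly Q"
  shows "P = Q"
  by (rule poly_eqI_degree[of UNIV]) (use assms in auto)

lemma coeff_subst_fst: "coeff (subst_fst f a) j = poly (coeff f j) a"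
  by (simp add: subst_fst_def coeff_map_poly)

lemma degree_subst_fst_le: "degree (subst_fst f a) \<le> degree f"
  by (rule degree_le) (simp add: coeff_subst_fst coeff_eq_0)

text \<open>One-variable interpolation is applied twice: for each fixed first argument it gives a
  polynomial in the second variable, and each coefficient of these, as a function of the first
  argument, is then interpolated in turn. Uniqueness follows the same two stages.\<close>

lemma bij_betw_eval2:
  "bij_betw eval2 {f :: 'a::{field,finite} poly poly. reduced_poly2 f} UNIV"
  unfolding bij_betw_def
proof
  show "inj_on eval2 {f :: 'a poly poly. reduced_poly2 f}"
  proof (rule inj_onI, clarsimp)
    fix f g :: "'a poly poly"
    assume red: "reduced_poly2 f" "reduced_poly2 g" and eq: "eval2 f = eval2 g"
    have "subst_fst f a = subst_fst g a" for a
    proof (rule reduced_poly_eqI)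
      show "poly (subst_fst f a) = poly (subst_fst g a)"
        using fun_cong[OF eq, of a] by (simp add: eval2_def[abs_def])
    qed (use red in \<open>auto simp: reduced_poly2_def intro: le_less_trans[OF degree_subst_fst_le]\<close>)
    then have "poly (coeff f j) a = poly (coeff g j) a" for j a
      by (metis coeff_subst_fst)
    then have "coeff f j = coeff g j" for j
      using red by (intro reduced_poly_eqI) (auto simp: reduced_poly2_def)
    then show "f = g" by (simp add: poly_eq_iff)
  qed
  show "eval2 ` {f :: 'a poly poly. reduced_poly2 f} = UNIV"
  proof (intro equalityI subset_UNIV subsetI)
    fix F :: "'a \<Rightarrow> 'a \<Rightarrow> 'a"
    have "\<forall>a. \<exists>P. degree P < CARD('a) \<and> poly P = F a"
      using ex_poly_interpolating by blast
    then obtain P where P: "\<And>a. degree (P a) < CARD('a)" "\<And>a. poly (P a) = F a"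
      by metis
    have "\<forall>j. \<exists>Q. degree Q < CARD('a) \<and> poly Q = (\<lambda>a. coeff (P a) j)"
      using ex_poly_interpolating by blast
    then obtain Q where Q: "\<And>j. degree (Q j) < CARD('a)" "\<And>j. poly (Q j) = (\<lambda>a. coeff (P a) j)"
      by metis
    define f where "f = (\<Sum>j<CARD('a). monom (Q j) j)"
    have coeff_f: "coeff f j = (if j < CARD('a) then Q j else 0)" for j
      by (simp add: f_def coeff_sum)
    have "degree f < CARD('a)"
      unfolding f_def by (rule degree_sum_less) (auto intro: le_less_trans[OF degree_monom_le] simp: finite_UNIV_card_ge_0)
    then have red: "reduced_poly2 f"
      using Q(1) by (auto simp: reduced_poly2_def coeff_f)
    have "subst_fst f a = P a" for a
      using P(1)[of a] by (auto simp: poly_eq_iff coeff_subst_fst coeff_f Q(2) coeff_eq_0)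
    then have "eval2 f = F"
      using P(2) by (simp add: eval2_def[abs_def])
    with red show "F \<in> eval2 ` {f. reduced_poly2 f}" by blast
  qed
qed

section \<open>Bijections between finite sets, free and with one prescribed value\<close>

lemma card_bijections:
  assumes "finite A" "finite B" "card A = card B"
  shows "card {f \<in> extensional A. bij_betw f A B} = fact (card A)"
proof -
  obtain h where h: "bij_betw h A B"
    using assms finite_same_card_bij by blast
  \<comment> \<open>Relative to one fixed bijection \<open>h\<close>, the others differ by a
    permutation of \<open>B\<close>. Such permutations fix everything outside \<open>B\<close>,
    while \<open>extensional\<close> pins down the functions outside \<open>A\<close>, so both sides
    count each map once.\<close>
  have "bij_betw (\<lambda>\<pi>. restrict (\<pi> \<circ> h) A) {\<pi>. \<pi> permutes B} {f \<in> extensional A. bij_betw f A B}"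
  proof (rule bij_betw_byWitness[where f' = "\<lambda>f x. if x \<in> B then f (inv_into A h x) else x"])
    show "\<forall>\<pi>\<in>{\<pi>. \<pi> permutes B}. (\<lambda>x. if x \<in> B then restrict (\<pi> \<circ> h) A (inv_into A h x) else x) = \<pi>"
      using h by (auto simp: fun_eq_iff permutes_not_in bij_betw_inv_into_right
          dest: bij_betw_apply[OF bij_betw_inv_into])
    show "\<forall>f\<in>{f \<in> extensional A. bij_betw f A B}.
       restrict ((\<lambda>x. if x \<in> B then f (inv_into A h x) else x) \<circ> h) A = f"
      using h by (auto simp: fun_eq_iff bij_betw_inv_into_left extensional_def dest: bij_betw_apply)
    show "(\<lambda>\<pi>. restrict (\<pi> \<circ> h) A) ` {\<pi>. \<pi> permutes B} \<subseteq> {f \<in> extensional A. bij_betw f A B}"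
    proof clarsimp
      fix \<pi> assume "\<pi> permutes B"
      then show "bij_betw (\<pi> \<circ> h) A B"
        by (intro bij_betw_trans[OF h] permutes_imp_bij)
    qed
    show "(\<lambda>f x. if x \<in> B then f (inv_into A h x) else x) ` {f \<in> extensional A. bij_betw f A B}
      \<subseteq> {\<pi>. \<pi> permutes B}"
    proof clarsimp
      fix f assume "bij_betw f A B"
      then have "bij_betw (f \<circ> inv_into A h) B B"
        using bij_betw_inv_into[OF h] bij_betw_trans by blast
      then have "bij_betw (\<lambda>x. if x \<in> B then f (inv_into A h x) else x) B B"
        by (rule bij_betw_cong[THEN iffD1, rotated]) auto
      then show "(\<lambda>x. if x \<in> B then f (inv_into A h x) else x) permutes B"
        by (rule bij_imp_permutes) auto
    qed
  qed
  from bij_betw_same_card[OF this] show ?thesis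
    using card_permutations[OF assms(3)[symmetric] assms(2)] by simp
qed

lemma card_bijections_pointed:
  assumes "finite A" "finite B" "card A = card B" "a \<in> A" "b \<in> B"
  shows "card {f \<in> extensional A. bij_betw f A B \<and> f a = b} = fact (card A - 1)"
proof -
  let ?S = "{f \<in> extensional A. bij_betw f A B \<and> f a = b}"
  let ?T = "{f \<in> extensional (A - {a}). bij_betw f (A - {a}) (B - {b})}"
  have "bij_betw (\<lambda>f. restrict f (A - {a})) ?S ?T"
  proof (rule bij_betw_byWitness[where f' = "\<lambda>f. f(a := b)"])
    show "\<forall>f\<in>?S. (restrict f (A - {a}))(a := b) = f"
      using assms by (auto simp: fun_eq_iff extensional_def)
    show "\<forall>f\<in>?T. restrict (f(a := b)) (A - {a}) = f"
      by (auto simp: fun_eq_iff extensional_def)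
    show "(\<lambda>f. restrict f (A - {a})) ` ?S \<subseteq> ?T"
      using assms by (auto simp: bij_betw_def inj_on_def)
    show "(\<lambda>f. f(a := b)) ` ?T \<subseteq> ?S"
    proof clarsimp
      fix f assume f: "f \<in> extensional (A - {a})" "bij_betw f (A - {a}) (B - {b})"
      have "bij_betw (f(a := b)) (A - {a}) (B - {b})"
        using f(2) by (rule bij_betw_cong[THEN iffD1, rotated]) auto
      moreover have "bij_betw (f(a := b)) {a} {b}" by simp
      ultimately have "bij_betw (f(a := b)) (A - {a} \<union> {a}) (B - {b} \<union> {b})"
        by (rule bij_betw_combine) auto
      moreover have "A - {a} \<union> {a} = A" "B - {b} \<union> {b} = B"
        using assms by auto
      ultimately show "f(a := b) \<in> extensional A \<and> bij_betw (f(a := b)) A B"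
        using f(1) assms(4) by (auto simp: extensional_def)
    qed
  qed
  then have "card ?S = card ?T" by (rule bij_betw_same_card)
  also have "\<dots> = fact (card (A - {a}))"
    using assms by (intro card_bijections) auto
  finally show ?thesis using assms by simp
qed

section \<open>Orderings of sharply transitive groups\<close>

definition sharply_transitive :: "('a \<Rightarrow> 'a) set \<Rightarrow> bool" where
  "sharply_transitive K \<longleftrightarrow> (\<forall>x y. \<exists>!k. k \<in> K \<and> k x = y)"

text \<open>Moves the test from \<open>K\<close> to an indexing of \<open>K\<close>. It serves both
  for orderings by \<open>{..<q}\<close> and for group isomorphisms onto \<open>K\<close>.\<close>

lemma sharply_transitive_iff:
  assumes "bij_betw \<rho> A K"
  shows "sharply_transitive K \<longleftrightarrow> (\<forall>x y. \<exists>!g. g \<in> A \<and> \<rho> g x = y)"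
proof -
  have K: "K = \<rho> ` A" and inj: "\<And>g h. g \<in> A \<Longrightarrow> h \<in> A \<Longrightarrow> \<rho> g = \<rho> h \<Longrightarrow> g = h"
    using assms by (auto simp: bij_betw_def inj_on_def)
  have "(\<exists>!k. k \<in> K \<and> k x = y) \<longleftrightarrow> (\<exists>!g. g \<in> A \<and> \<rho> g x = y)" (is "?L \<longleftrightarrow> ?R") for x y
  proof
    assume ?L
    then obtain g where "g \<in> A" "\<rho> g x = y" "\<And>k. k \<in> K \<Longrightarrow> k x = y \<Longrightarrow> k = \<rho> g"
      unfolding K by blast
    then show ?R unfolding K by (intro ex1I[of _ g]) (auto intro: inj)
  next
    assume ?R
    then obtain g where g: "g \<in> A" "\<rho> g x = y" "\<And>h. h \<in> A \<Longrightarrow> \<rho> h x = y \<Longrightarrow> h = g"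
      by blast
    show ?L
    proof (rule ex1I[of _ "\<rho> g"])
      show "\<rho> g \<in> K \<and> \<rho> g x = y" using g(1,2) by (simp add: K)
      fix k assume "k \<in> K \<and> k x = y"
      then obtain h where "h \<in> A" "k = \<rho> h" "\<rho> h x = y" by (auto simp: K)
      with g(3)[of h] show "k = \<rho> g" by simp
    qed
  qed
  then show ?thesis by (simp add: sharply_transitive_def)
qed

abbreviation regular_subgroups :: "('a \<Rightarrow> 'a) set set" where
  "regular_subgroups \<equiv> {K. subgroup K (BijGroup UNIV) \<and> sharply_transitive K}"

lemma carrier_BijGroup_UNIV: "carrier (BijGroup UNIV) = {f. bij f}"
  by (simp add: BijGroup_def Bij_def)

lemma mult_BijGroup_UNIV:
  "bij f \<Longrightarrow> bij g \<Longrightarrow> f \<otimes>\<^bsub>BijGroup UNIV\<^esub> g = f \<circ> g"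
  by (simp add: BijGroup_def Bij_def compose_def fun_eq_iff)

section \<open>Local permutation polynomials as orderings of sharply transitive sets\<close>

lemma local_permutation_poly_iff:
  "local_permutation_poly f \<longleftrightarrow>
    reduced_poly2 f \<and> (\<forall>x. bij (eval2 f x)) \<and> (\<forall>y. bij (\<lambda>x. eval2 f x y))"
proof -
  have "poly (subst_fst f a) = eval2 f a" "poly (subst_snd f a) = (\<lambda>x. eval2 f x a)" for a
    by (simp_all add: eval2_def[abs_def] poly_subst_snd[unfolded eval2_def, symmetric] fun_eq_iff)
  then show ?thesis by (auto simp: local_permutation_poly_def permutation_poly_def)
qed

lemma perm_tuple_eqI:
  assumes "local_permutation_poly f" "eval2 f x y = c i"
  shows "perm_tuple c f i x = y"
proof -
  have "inj (eval2 f x)"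
    using assms(1) by (simp add: local_permutation_poly_iff bij_is_inj)
  then show ?thesis
    using eval2_perm_tuple[OF assms(1), of x c i] assms(2) by (metis injD)
qed

text \<open>The tuple of \<open>f\<close>, restricted to indices below q, is an ordering of its
  associated set, and it determines \<open>f\<close>; conversely every ordering of a member of
  \<open>\<K>\<close> comes from some \<open>f\<close>. A sharply transitive set has q elements,
  hence q! orderings.\<close>

lemma card_local_permutation_polys:
  fixes c :: "nat \<Rightarrow> 'a::{field,finite}" and \<K> :: "('a \<Rightarrow> 'a) set set"
  assumes c: "bij_betw c {..<CARD('a)} UNIV"
    and trans: "\<And>K. K \<in> \<K> \<Longrightarrow> sharply_transitive K"
    and bij: "\<And>K k. K \<in> \<K> \<Longrightarrow> k \<in> K \<Longrightarrow> bij k"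
  shows "card {f. local_permutation_poly f \<and> associated_set c f \<in> \<K>} = fact CARD('a) * card \<K>"
proof -
  let ?q = "CARD('a)"
  let ?B = "\<lambda>K :: ('a \<Rightarrow> 'a) set. {\<beta> \<in> extensional {..<?q}. bij_betw \<beta> {..<?q} K}"
  let ?T = "\<lambda>f. restrict (perm_tuple c f) {..<?q}"
  have bij_T: "bij_betw (perm_tuple c f) {..<?q} (associated_set c f)"
    if "local_permutation_poly f" for f
    unfolding associated_set_def
  proof (intro inj_on_imp_bij_betw inj_onI)
    fix i j assume ij: "i \<in> {..<?q}" "j \<in> {..<?q}" "perm_tuple c f i = perm_tuple c f j"
    have "c i = c j"
      \<comment> \<open>\<open>undefined\<close> is just a point of the field: the two permutations
        agree there, and \<open>f\<close> takes the values \<open>c i\<close> and \<open>c j\<close>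
        at the same pair.\<close>
      using eval2_perm_tuple[OF that, of undefined c i] eval2_perm_tuple[OF that, of undefined c j] ij(3)
      by simp
    with ij(1,2) show "i = j"
      using bij_betw_imp_inj_on[OF c] by (simp add: inj_on_eq_iff)
  qed
  have "bij_betw ?T {f. local_permutation_poly f \<and> associated_set c f \<in> \<K>} (\<Union>K\<in>\<K>. ?B K)"
  proof (rule bij_betw_imageI)
    show "inj_on ?T {f. local_permutation_poly f \<and> associated_set c f \<in> \<K>}"
    proof (rule inj_onI, clarify)
      fix f g
      assume f: "local_permutation_poly f" and g: "local_permutation_poly g" and eq: "?T f = ?T g"
      have pt: "perm_tuple c f i = perm_tuple c g i" if "i < ?q" for i
        using fun_cong[OF eq, of i] that by simp
      have "eval2 f x y = eval2 g x y" for x y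
      proof -
        obtain i where i: "i < ?q" "eval2 f x y = c i"
          using bij_betw_imp_surj_on[OF c] by (auto simp: set_eq_iff image_iff)
        have "y = perm_tuple c f i x"
          using perm_tuple_eqI[of f x y c i] f i(2) by simp
        then show ?thesis
          using i pt eval2_perm_tuple[OF g, of x c i] by simp
      qed
      then have "eval2 f = eval2 g" by (simp add: fun_eq_iff)
      then show "f = g"
        using f g by (intro inj_onD[OF bij_betw_imp_inj_on[OF bij_betw_eval2]])
          (simp_all add: local_permutation_poly_iff)
    qed
    show "?T ` {f. local_permutation_poly f \<and> associated_set c f \<in> \<K>} = (\<Union>K\<in>\<K>. ?B K)"
    proof (intro equalityI subsetI)
      fix \<beta> assume "\<beta> \<in> ?T ` {f. local_permutation_poly f \<and> associated_set c f \<in> \<K>}"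
      then obtain f where f: "local_permutation_poly f" "associated_set c f \<in> \<K>" "\<beta> = ?T f"
        by blast
      have "bij_betw \<beta> {..<?q} (associated_set c f)"
        using bij_T[OF f(1)] unfolding f(3) by (rule bij_betw_cong[THEN iffD1, rotated]) auto
      with f show "\<beta> \<in> (\<Union>K\<in>\<K>. ?B K)" by auto
    next
      fix \<beta> assume "\<beta> \<in> (\<Union>K\<in>\<K>. ?B K)"
      then obtain K where K: "K \<in> \<K>" and \<beta>: "\<beta> \<in> extensional {..<?q}" "bij_betw \<beta> {..<?q} K"
        by blast
      \<comment> \<open>\<open>J x y\<close> is the index of the only permutation in the ordering
        that sends \<open>x\<close> to \<open>y\<close>. Labelling the pair by
        \<open>c (J x y)\<close> is forced by the requirement f(x, \<beta>_i(x)) = c_i.\<close>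
      define J where "J x y = (THE i. i < ?q \<and> \<beta> i x = y)" for x y
      have ex1: "\<exists>!i. i < ?q \<and> \<beta> i x = y" for x y
        using trans[OF K] sharply_transitive_iff[OF \<beta>(2)] by simp
      have J: "J x y < ?q" "\<beta> (J x y) x = y" for x y
        using theI'[OF ex1[of x y]] by (auto simp: J_def)
      have J_eq: "J x (\<beta> i x) = i" if "i < ?q" for i x
        using ex1[of x "\<beta> i x"] J[of x "\<beta> i x"] that by blast
      define F where "F x y = c (J x y)" for x y
      have c_inj: "i = j" if "c i = c j" "i < ?q" "j < ?q" for i j
        using bij_betw_imp_inj_on[OF c] that by (simp add: inj_on_def)
      have F1: "bij (F x)" for x
      proof -
        have "inj (F x)"
        proof (rule injI)
          fix y y' assume "F x y = F x y'"
          then have "J x y = J x y'" by (intro c_inj) (simp_all add: F_def J(1))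
          then show "y = y'" by (metis J(2))
        qed
        then show ?thesis by (simp add: finite_UNIV_inj_surj bij_def)
      qed
      \<comment> \<open>For fixed \<open>y\<close>, equal values give one index i with \<beta>_i(x)
        = y = \<beta>_i(x'). Here the members of \<open>K\<close> have to be injective.\<close>
      have F2: "bij (\<lambda>x. F x y)" for y
      proof -
        have "inj (\<lambda>x. F x y)"
        proof (rule injI)
          fix x x' assume "F x y = F x' y"
          then have "J x y = J x' y" by (intro c_inj) (simp_all add: F_def J(1))
          then have "\<beta> (J x y) x = \<beta> (J x y) x'" by (metis J(2))
          moreover have "bij (\<beta> (J x y))"
            using bij_betwE[OF \<beta>(2)] J(1) by (intro bij[OF K]) auto
          ultimately show "x = x'" by (simp add: bij_is_inj inj_eq)
        qed
        then show ?thesis by (simp add: finite_UNIV_inj_surj bij_def)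
      qed
      have "F \<in> eval2 ` {f. reduced_poly2 f}"
        by (simp add: bij_betw_imp_surj_on[OF bij_betw_eval2])
      then obtain f where f: "reduced_poly2 f" "eval2 f = F"
        by auto
      then have lpp: "local_permutation_poly f"
        using F1 F2 by (simp add: local_permutation_poly_iff)
      have pt: "perm_tuple c f i = \<beta> i" if "i < ?q" for i
      proof
        fix x
        have "eval2 f x (\<beta> i x) = c i"
          using that by (simp add: f(2) F_def J_eq)
        then show "perm_tuple c f i x = \<beta> i x"
          by (rule perm_tuple_eqI[of f x _ c, OF lpp])
      qed
      then have "associated_set c f = K"
        using \<beta>(2) by (auto simp: associated_set_def bij_betw_def)
      moreover have "?T f = \<beta>"
        using pt \<beta>(1) by (auto simp: fun_eq_iff extensional_def)
      ultimately show "\<beta> \<in> ?T ` {f. local_permutation_poly f \<and> associated_set c f \<in> \<K>}"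
        using lpp K by blast
    qed
  qed
  then have "card {f. local_permutation_poly f \<and> associated_set c f \<in> \<K>} = card (\<Union>K\<in>\<K>. ?B K)"
    by (rule bij_betw_same_card)
  also have "\<dots> = (\<Sum>K\<in>\<K>. card (?B K))"
  proof (rule card_UN_disjoint)
    show "finite \<K>" by simp
    have "finite (?B K)" for K
    proof (rule finite_subset)
      show "?B K \<subseteq> {..<?q} \<rightarrow>\<^sub>E UNIV" by (simp add: subset_iff PiE_def)
      show "finite ({..<?q} \<rightarrow>\<^sub>E (UNIV :: ('a \<Rightarrow> 'a) set))" by (intro finite_PiE) auto
    qed
    then show "\<forall>K\<in>\<K>. finite (?B K)" by blast
    have "K = L" if "\<beta> \<in> ?B K" "\<beta> \<in> ?B L" for K L \<beta>
      using that bij_betw_imp_surj_on[of \<beta> "{..<?q}" K] bij_betw_imp_surj_on[of \<beta> "{..<?q}" L]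
      by simp
    then show "\<forall>K\<in>\<K>. \<forall>L\<in>\<K>. K \<noteq> L \<longrightarrow> ?B K \<inter> ?B L = {}"
      by blast
  qed
  also have "\<dots> = (\<Sum>K\<in>\<K>. fact ?q)"
  proof (rule sum.cong[OF refl])
    fix K assume K: "K \<in> \<K>"
    \<comment> \<open>Evaluation at any single point identifies a sharply transitive set with the
      field.\<close>
    have "bij_betw (\<lambda>k. k undefined) K UNIV"
    proof (rule bij_betwI')
      have ex1: "\<exists>!k. k \<in> K \<and> k undefined = y" for y
        using trans[OF K] by (simp add: sharply_transitive_def)
      show "(k undefined = k' undefined) = (k = k')" if "k \<in> K" "k' \<in> K" for k k'
        using ex1[of "k undefined"] that by auto
      show "\<exists>k\<in>K. y = k undefined" for y
        using ex1[of y] by auto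
    qed simp
    then have "card K = ?q" by (rule bij_betw_same_card)
    then show "card (?B K) = fact ?q"
      using card_bijections[of "{..<?q}" K] by simp
  qed
  finally show ?thesis by simp
qed

text \<open>The member sending \<open>x\<close> to \<open>y\<close> is the one whose index i
  satisfies c_i = f(x, y).\<close>

lemma sharply_transitive_associated_set:
  fixes c :: "nat \<Rightarrow> 'a::{field,finite}"
  assumes c: "bij_betw c {..<CARD('a)} UNIV" and f: "local_permutation_poly f"
  shows "sharply_transitive (associated_set c f)"
  unfolding sharply_transitive_def
proof (intro allI)
  fix x y
  obtain i where i: "i < CARD('a)" "eval2 f x y = c i"
    using bij_betw_imp_surj_on[OF c] by (auto simp: set_eq_iff image_iff)
  show "\<exists>!k. k \<in> associated_set c f \<and> k x = y"
  proof (intro ex1I[of _ "perm_tuple c f i"] conjI)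
    show "perm_tuple c f i \<in> associated_set c f"
      using i(1) by (simp add: associated_set_def)
    show "perm_tuple c f i x = y"
      using perm_tuple_eqI[of f x y c i, OF f] i(2) by simp
    fix k assume "k \<in> associated_set c f \<and> k x = y"
    then obtain j where j: "j < CARD('a)" "k = perm_tuple c f j" "perm_tuple c f j x = y"
      by (auto simp: associated_set_def)
    then have "c j = c i" using eval2_perm_tuple[OF f, of x c j] i(2) by simp
    then have "j = i"
      using bij_betw_imp_inj_on[OF c] i(1) j(1) by (simp add: inj_on_def)
    with j show "k = perm_tuple c f i" by simp
  qed
qed

section \<open>Regular representations of a finite group\<close>

context group
begin

text \<open>Values outside the carrier are fixed by \<open>extensional\<close>, so that
  cardinalities count actions of the group. The last clause is regularity of the action.\<close>

definition regular_reps :: "('a \<Rightarrow> 'c \<Rightarrow> 'c) set" where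
  "regular_reps = {\<rho> \<in> extensional (carrier G). \<rho> \<in> hom G (BijGroup UNIV) \<and>
     (\<forall>x y. \<exists>!g. g \<in> carrier G \<and> \<rho> g x = y)}"

text \<open>Left translation of the group, carried to \<open>'c\<close> by conjugation with
  \<open>\<sigma>\<close>.\<close>

definition transported_rep :: "('a \<Rightarrow> 'c) \<Rightarrow> 'a \<Rightarrow> 'c \<Rightarrow> 'c" where
  "transported_rep \<sigma> = (\<lambda>g\<in>carrier G. \<lambda>x. \<sigma> (g \<otimes> inv_into (carrier G) \<sigma> x))"

lemma transported_rep_apply:
  assumes "bij_betw \<sigma> (carrier G) UNIV" "g \<in> carrier G" "h \<in> carrier G"
  shows "transported_rep \<sigma> g (\<sigma> h) = \<sigma> (g \<otimes> h)"
  using assms by (simp add: transported_rep_def bij_betw_inv_into_left)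

text \<open>Left translation is regular, since \<open>k \<otimes> inv h\<close> is the only element
  moving \<open>h\<close> to \<open>k\<close>; \<open>\<sigma>\<close> merely renames the
  points.\<close>

lemma transported_rep_in_regular_reps:
  assumes \<sigma>: "bij_betw \<sigma> (carrier G) UNIV"
  shows "transported_rep \<sigma> \<in> regular_reps"
proof -
  let ?\<rho> = "transported_rep \<sigma>"
  have surj: "\<exists>h\<in>carrier G. x = \<sigma> h" for x
    using \<sigma> by (metis UNIV_I bij_betw_iff_bijections)
  have inj: "g = h" if "\<sigma> g = \<sigma> h" "g \<in> carrier G" "h \<in> carrier G" for g h
    using \<sigma> that by (metis bij_betw_imp_inj_on inj_on_eq_iff)
  have mult: "?\<rho> (g \<otimes> h) x = ?\<rho> g (?\<rho> h x)" if "g \<in> carrier G" "h \<in> carrier G" for g h x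
    using surj[of x] that by (auto simp: transported_rep_apply[OF \<sigma>] m_assoc)
  have one: "?\<rho> \<one> x = x" for x
    using surj[of x] by (auto simp: transported_rep_apply[OF \<sigma>])
  have bij: "bij (?\<rho> g)" if "g \<in> carrier G" for g
  proof (rule o_bij[of "?\<rho> (inv g)"])
    show "?\<rho> (inv g) \<circ> ?\<rho> g = id" "?\<rho> g \<circ> ?\<rho> (inv g) = id"
      using that by (auto simp: fun_eq_iff one simp flip: mult)
  qed
  have "\<exists>!g. g \<in> carrier G \<and> ?\<rho> g x = y" for x y
  proof -
    obtain h k where hk: "h \<in> carrier G" "x = \<sigma> h" "k \<in> carrier G" "y = \<sigma> k"
      using surj by metis
    show ?thesis
    proof (rule ex1I[of _ "k \<otimes> inv h"])
      show "k \<otimes> inv h \<in> carrier G \<and> ?\<rho> (k \<otimes> inv h) x = y"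
        using hk by (simp add: transported_rep_apply[OF \<sigma>] m_assoc)
      fix g assume "g \<in> carrier G \<and> ?\<rho> g x = y"
      then have "g \<in> carrier G" "g \<otimes> h = k"
        using hk by (auto simp: transported_rep_apply[OF \<sigma>] intro: inj)
      then show "g = k \<otimes> inv h" using hk by (auto simp: m_assoc)
    qed
  qed
  moreover have "?\<rho> \<in> hom G (BijGroup UNIV)"
    using bij by (auto simp: hom_def carrier_BijGroup_UNIV mult_BijGroup_UNIV mult fun_eq_iff)
  moreover have "?\<rho> \<in> extensional (carrier G)"
    by (simp add: transported_rep_def)
  ultimately show ?thesis by (simp add: regular_reps_def)
qed

lemma regular_reps_hom_mult:
  assumes "\<rho> \<in> regular_reps" "g \<in> carrier G" "h \<in> carrier G"
  shows "\<rho> (g \<otimes> h) x = \<rho> g (\<rho> h x)"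
  using assms
  by (auto simp: regular_reps_def hom_def carrier_BijGroup_UNIV Pi_iff mult_BijGroup_UNIV)

text \<open>For an arbitrary base point \<open>x0\<close>, taking the orbit map
  \<open>g \<mapsto> \<rho> g x0\<close> is inverse to transporting left translation:
  \<open>\<rho> g (\<rho> h x0) = \<rho> (g \<otimes> h) x0\<close> says that \<open>\<rho>\<close>
  is left translation renamed by its orbit map. The orbit maps are exactly the bijections sending
  \<open>\<one>\<close> to \<open>x0\<close>.\<close>

lemma card_regular_reps:
  assumes card: "card (carrier G) = CARD('c::finite)"
  shows "card (regular_reps :: ('a \<Rightarrow> 'c \<Rightarrow> 'c) set) = fact (CARD('c) - 1)"
proof -
  fix x0 :: 'c
  let ?S = "{\<sigma> \<in> extensional (carrier G). bij_betw \<sigma> (carrier G) (UNIV :: 'c set) \<and> \<sigma> \<one> = x0}"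
  \<comment> \<open>\<open>\<rho> \<one>\<close> is an injective idempotent, hence the
    identity.\<close>
  have one: "\<rho> \<one> x = x" if \<rho>: "\<rho> \<in> regular_reps" for \<rho> :: "'a \<Rightarrow> 'c \<Rightarrow> 'c" and x
  proof -
    have "inj (\<rho> \<one>)"
      using \<rho> by (auto simp: regular_reps_def hom_def carrier_BijGroup_UNIV Pi_iff bij_is_inj)
    moreover have "\<rho> \<one> (\<rho> \<one> x) = \<rho> \<one> x"
      using regular_reps_hom_mult[OF \<rho>, of \<one> \<one> x] by simp
    ultimately show ?thesis by (simp add: inj_eq)
  qed
  have "bij_betw (\<lambda>\<rho>. \<lambda>g\<in>carrier G. \<rho> g x0) (regular_reps :: ('a \<Rightarrow> 'c \<Rightarrow> 'c) set) ?S"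
  proof (rule bij_betw_byWitness[where f' = transported_rep])
    show img: "(\<lambda>\<rho>. \<lambda>g\<in>carrier G. \<rho> g x0) ` (regular_reps :: ('a \<Rightarrow> 'c \<Rightarrow> 'c) set) \<subseteq> ?S"
    proof clarify
      fix \<rho> :: "'a \<Rightarrow> 'c \<Rightarrow> 'c" assume \<rho>: "\<rho> \<in> regular_reps"
      have "bij_betw (\<lambda>g\<in>carrier G. \<rho> g x0) (carrier G) UNIV"
      proof (intro bij_betwI')
        have ex1: "\<exists>!g. g \<in> carrier G \<and> \<rho> g x0 = y" for y
          using \<rho> by (simp add: regular_reps_def)
        show "((\<lambda>g\<in>carrier G. \<rho> g x0) g = (\<lambda>g\<in>carrier G. \<rho> g x0) h) = (g = h)"
          if "g \<in> carrier G" "h \<in> carrier G" for g h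
          using ex1[of "\<rho> g x0"] that by auto
        show "\<exists>g\<in>carrier G. y = (\<lambda>g\<in>carrier G. \<rho> g x0) g" for y
          using ex1[of y] by auto
      qed simp
      then show "(\<lambda>g\<in>carrier G. \<rho> g x0) \<in> extensional (carrier G) \<and>
          bij_betw (\<lambda>g\<in>carrier G. \<rho> g x0) (carrier G) UNIV \<and> (\<lambda>g\<in>carrier G. \<rho> g x0) \<one> = x0"
        using one[OF \<rho>] by simp
    qed
    show "transported_rep ` ?S \<subseteq> regular_reps"
      using transported_rep_in_regular_reps by blast
    show "\<forall>\<rho>\<in>regular_reps. transported_rep (\<lambda>g\<in>carrier G. \<rho> g x0) = \<rho>"
    proof
      fix \<rho> :: "'a \<Rightarrow> 'c \<Rightarrow> 'c" assume \<rho>: "\<rho> \<in> regular_reps"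
      let ?\<sigma> = "\<lambda>g\<in>carrier G. \<rho> g x0"
      have \<sigma>: "bij_betw ?\<sigma> (carrier G) UNIV" using img \<rho> by blast
      have "transported_rep ?\<sigma> g x = \<rho> g x" if g: "g \<in> carrier G" for g x
      proof -
        obtain h where h: "h \<in> carrier G" "x = ?\<sigma> h"
          using \<sigma> by (metis UNIV_I bij_betw_iff_bijections)
        then show ?thesis
          using transported_rep_apply[OF \<sigma> g h(1)] regular_reps_hom_mult[OF \<rho> g h(1)] g by simp
      qed
      moreover have "\<rho> \<in> extensional (carrier G)"
        using \<rho> by (simp add: regular_reps_def)
      ultimately show "transported_rep ?\<sigma> = \<rho>"
        by (intro extensionalityI[of _ "carrier G"]) (auto simp: transported_rep_def)
    qed
    show "\<forall>\<sigma>\<in>?S. (\<lambda>g\<in>carrier G. transported_rep \<sigma> g x0) = \<sigma>"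
    proof
      fix \<sigma> assume "\<sigma> \<in> ?S"
      then have \<sigma>: "bij_betw \<sigma> (carrier G) UNIV" "\<sigma> \<in> extensional (carrier G)" "\<sigma> \<one> = x0"
        by auto
      then show "(\<lambda>g\<in>carrier G. transported_rep \<sigma> g x0) = \<sigma>"
        using transported_rep_apply[OF \<sigma>(1) _ one_closed]
        by (intro extensionalityI[of _ "carrier G"]) auto
    qed
  qed
  then have "card (regular_reps :: ('a \<Rightarrow> 'c \<Rightarrow> 'c) set) = card ?S"
    by (rule bij_betw_same_card)
  also have "\<dots> = fact (card (carrier G) - 1)"
  proof (rule card_bijections_pointed)
    show "finite (carrier G)"
      using card by (intro card_ge_0_finite) simp
  qed (use card in auto)
  finally show ?thesis using card by simp
qed

text \<open>Regularity gives faithfulness: if two elements act by the same permutation, they agree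
  at a point and so coincide.\<close>

lemma regular_rep_iso:
  assumes \<rho>: "\<rho> \<in> regular_reps"
  shows "subgroup (\<rho> ` carrier G) (BijGroup UNIV)" "sharply_transitive (\<rho> ` carrier G)"
    "\<rho> \<in> iso G ((BijGroup UNIV)\<lparr>carrier := \<rho> ` carrier G\<rparr>)"
proof -
  interpret gh: group_hom G "BijGroup UNIV" \<rho>
    using \<rho> group_BijGroup by (auto simp: regular_reps_def group_hom_def group_hom_axioms_def is_group)
  show "subgroup (\<rho> ` carrier G) (BijGroup UNIV)"
    by (rule gh.img_is_subgroup)
  have ex1: "\<exists>!g. g \<in> carrier G \<and> \<rho> g x = y" for x y
    using \<rho> by (auto simp: regular_reps_def)
  have inj: "inj_on \<rho> (carrier G)"
    by (rule inj_onI) (use ex1 in metis)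
  then show "sharply_transitive (\<rho> ` carrier G)"
    using ex1 by (subst sharply_transitive_iff[OF inj_on_imp_bij_betw]) auto
  from inj show "\<rho> \<in> iso G ((BijGroup UNIV)\<lparr>carrier := \<rho> ` carrier G\<rparr>)"
    using gh.homh by (auto simp: iso_def hom_def bij_betw_def)
qed

lemma iso_compose:
  assumes "\<theta> \<in> iso G H" "h \<in> iso H I"
  shows "compose (carrier G) h \<theta> \<in> iso G I"
  using assms hom_compose[of \<theta> H h I] by (auto simp: iso_def intro: bij_betw_compose)

text \<open>Sharp transitivity of \<open>K\<close> makes the regular representations with image
  \<open>K\<close> the same as the isomorphisms from the group onto \<open>K\<close>. Once one
  isomorphism \<open>h\<close> is fixed, every other is \<open>h\<close> after a unique
  automorphism.\<close>

lemma card_regular_reps_with_image: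
  assumes K: "subgroup K (BijGroup UNIV)" "sharply_transitive K"
    and iso: "(BijGroup UNIV)\<lparr>carrier := K\<rparr> \<cong> G"
  shows "card {\<rho> \<in> regular_reps. \<rho> ` carrier G = K} = card (auto G)"
proof -
  let ?B = "(BijGroup UNIV)\<lparr>carrier := K\<rparr>"
  have grp: "group ?B" by (rule subgroup.subgroup_is_group[OF K(1) group_BijGroup])
  obtain h where h: "h \<in> iso G ?B"
    using iso group.iso_sym[OF grp] by (auto simp: is_iso_def)
  then have h_bij: "bij_betw h (carrier G) K" by (simp add: iso_def)
  have h_inv: "inv_into (carrier G) h \<in> iso ?B G" using iso_set_sym[OF h] .
  have auto_iff: "\<theta> \<in> auto G \<longleftrightarrow> \<theta> \<in> iso G G \<and> \<theta> \<in> extensional (carrier G)" for \<theta>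
    by (auto simp: auto_def iso_def Bij_def)
  have rep_iff: "\<rho> \<in> regular_reps \<and> \<rho> ` carrier G = K \<longleftrightarrow>
      \<rho> \<in> iso G ?B \<and> \<rho> \<in> extensional (carrier G)" for \<rho>
  proof
    assume "\<rho> \<in> regular_reps \<and> \<rho> ` carrier G = K"
    then show "\<rho> \<in> iso G ?B \<and> \<rho> \<in> extensional (carrier G)"
      using regular_rep_iso(3)[of \<rho>] by (auto simp: regular_reps_def)
  next
    assume \<rho>: "\<rho> \<in> iso G ?B \<and> \<rho> \<in> extensional (carrier G)"
    then have b: "bij_betw \<rho> (carrier G) K" by (simp add: iso_def)
    have "\<exists>!g. g \<in> carrier G \<and> \<rho> g x = y" for x y
      using K(2) sharply_transitive_iff[OF b] by simp
    moreover have "\<rho> \<in> hom G (BijGroup UNIV)"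
      using \<rho> subgroup.subset[OF K(1)] by (auto simp: iso_def hom_def)
    ultimately show "\<rho> \<in> regular_reps \<and> \<rho> ` carrier G = K"
      using \<rho> b by (auto simp: regular_reps_def bij_betw_def)
  qed
  have "bij_betw (\<lambda>\<theta>. compose (carrier G) h \<theta>) (auto G) {\<rho> \<in> regular_reps. \<rho> ` carrier G = K}"
  proof (rule bij_betw_byWitness[where f' = "\<lambda>\<rho>. compose (carrier G) (inv_into (carrier G) h) \<rho>"])
    show "\<forall>\<theta>\<in>auto G. compose (carrier G) (inv_into (carrier G) h) (compose (carrier G) h \<theta>) = \<theta>"
    proof
      fix \<theta> assume \<theta>: "\<theta> \<in> auto G"
      then have "\<theta> g \<in> carrier G" if "g \<in> carrier G" for g
        using that by (auto simp: auto_def hom_def)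
      with \<theta> h_bij show "compose (carrier G) (inv_into (carrier G) h) (compose (carrier G) h \<theta>) = \<theta>"
        by (intro extensionalityI[of _ "carrier G"])
          (auto simp: auto_iff compose_eq bij_betw_inv_into_left)
    qed
    show "\<forall>\<rho>\<in>{\<rho> \<in> regular_reps. \<rho> ` carrier G = K}.
        compose (carrier G) h (compose (carrier G) (inv_into (carrier G) h) \<rho>) = \<rho>"
    proof clarify
      fix \<rho> assume \<rho>: "\<rho> \<in> regular_reps" "K = \<rho> ` carrier G"
      with h_bij show "compose (carrier G) h (compose (carrier G) (inv_into (carrier G) h) \<rho>) = \<rho>"
        by (intro extensionalityI[of _ "carrier G"])
          (auto simp: regular_reps_def compose_eq bij_betw_inv_into_right)
    qed
    show "compose (carrier G) h ` auto G \<subseteq> {\<rho> \<in> regular_reps. \<rho> ` carrier G = K}"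
    proof clarify
      fix \<theta> assume "\<theta> \<in> auto G"
      then have "compose (carrier G) h \<theta> \<in> iso G ?B"
        using h iso_compose by (auto simp: auto_iff)
      then show "compose (carrier G) h \<theta> \<in> regular_reps \<and> compose (carrier G) h \<theta> ` carrier G = K"
        by (simp add: rep_iff)
    qed
    show "compose (carrier G) (inv_into (carrier G) h) ` {\<rho> \<in> regular_reps. \<rho> ` carrier G = K} \<subseteq> auto G"
      using h_inv iso_compose by (auto simp: auto_iff rep_iff)
  qed
  from bij_betw_same_card[OF this] show ?thesis by simp
qed

text \<open>The double count, sorting the regular representations by their image. The product form
  avoids division of natural numbers.\<close>

lemma card_regular_subgroups_iso:
  assumes card: "card (carrier G) = CARD('c::finite)"
  shows "card {K :: ('c \<Rightarrow> 'c) set. K \<in> regular_subgroups \<and> (BijGroup UNIV)\<lparr>carrier := K\<rparr> \<cong> G}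
    * card (auto G) = fact (CARD('c) - 1)"
proof -
  let ?\<K> = "{K :: ('c \<Rightarrow> 'c) set. K \<in> regular_subgroups \<and> (BijGroup UNIV)\<lparr>carrier := K\<rparr> \<cong> G}"
  let ?R = "\<lambda>K. {\<rho> \<in> regular_reps :: ('a \<Rightarrow> 'c \<Rightarrow> 'c) set. \<rho> ` carrier G = K}"
  have "finite (regular_reps :: ('a \<Rightarrow> 'c \<Rightarrow> 'c) set)"
    using card_regular_reps[OF card] by (intro card_ge_0_finite) simp
  have "(regular_reps :: ('a \<Rightarrow> 'c \<Rightarrow> 'c) set) = (\<Union>K\<in>?\<K>. ?R K)"
  proof (intro equalityI subsetI)
    fix \<rho> :: "'a \<Rightarrow> 'c \<Rightarrow> 'c" assume \<rho>: "\<rho> \<in> regular_reps"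
    have "(BijGroup UNIV)\<lparr>carrier := \<rho> ` carrier G\<rparr> \<cong> G"
      using iso_sym is_isoI[OF regular_rep_iso(3)[OF \<rho>]] by blast
    with \<rho> regular_rep_iso(1,2)[OF \<rho>] show "\<rho> \<in> (\<Union>K\<in>?\<K>. ?R K)" by auto
  qed auto
  then have "fact (CARD('c) - 1) = card (\<Union>K\<in>?\<K>. ?R K)"
    using card_regular_reps[OF card] by simp
  also have "\<dots> = (\<Sum>K\<in>?\<K>. card (?R K))"
    by (rule card_UN_disjoint) (use \<open>finite regular_reps\<close> in auto)
  also have "\<dots> = (\<Sum>K\<in>?\<K>. card (auto G))"
    by (rule sum.cong) (auto intro: card_regular_reps_with_image)
  finally show ?thesis by simp
qed

end

section \<open>The Klenian group\<close>

lemma cycle_of_list_nth: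
  assumes "distinct cs" "k < length cs"
  shows "cycle_of_list cs (cs ! k) = cs ! (Suc k mod length cs)"
proof -
  have "map (cycle_of_list cs) cs ! k = rotate 1 cs ! k"
    using cyclic_rotation[OF assms(1), of 1] by simp
  then show ?thesis
    using assms(2) nth_rotate[of k cs 1] by simp
qed

lemma foldr_comp_cycles_outside:
  assumes "\<And>i. i \<in> set is \<Longrightarrow> x \<notin> set (L i)"
  shows "foldr (\<circ>) (map (\<lambda>i. cycle_of_list (L i)) is) id x = x"
  using assms by (induction "is") (auto simp: id_outside_supp)

text \<open>Factors applied before the cycle through \<open>x\<close> fix \<open>x\<close>. That
  cycle keeps the point inside its own list, so factors applied afterwards fix the result.\<close>

lemma foldr_comp_disjoint_cycles:
  assumes "\<And>j. j \<in> set is \<Longrightarrow> j \<noteq> i \<Longrightarrow> set (L i) \<inter> set (L j) = {}"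
    and "distinct is" "i \<in> set is" "x \<in> set (L i)"
  shows "foldr (\<circ>) (map (\<lambda>i. cycle_of_list (L i)) is) id x = cycle_of_list (L i) x"
  using assms
proof (induction "is")
  case (Cons j js)
  have step: "foldr (\<circ>) (map (\<lambda>i. cycle_of_list (L i)) (j # js)) id x =
      cycle_of_list (L j) (foldr (\<circ>) (map (\<lambda>i. cycle_of_list (L i)) js) id x)"
    by (simp only: list.map foldr.simps o_apply)
  show ?case
  proof (cases "i = j")
    case True
    have "foldr (\<circ>) (map (\<lambda>i. cycle_of_list (L i)) js) id x = x"
    proof (rule foldr_comp_cycles_outside)
      fix k assume k: "k \<in> set js"
      then have "k \<noteq> i" using Cons.prems(2) True by auto
      then show "x \<notin> set (L k)" using Cons.prems(1)[of k] Cons.prems(4) k by auto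
    qed
    with True show ?thesis by (simp only: step)
  next
    case False
    have "foldr (\<circ>) (map (\<lambda>i. cycle_of_list (L i)) js) id x = cycle_of_list (L i) x"
    proof (rule Cons.IH)
      show "set (L i) \<inter> set (L k) = {}" if "k \<in> set js" "k \<noteq> i" for k
        using that by (intro Cons.prems(1)) simp_all
      show "distinct js" using Cons.prems(2) by simp
      show "i \<in> set js" using Cons.prems(3) False by simp
      show "x \<in> set (L i)" by (rule Cons.prems(4))
    qed
    moreover have "cycle_of_list (L i) x \<in> set (L i)"
      using Cons.prems(4) by (simp add: permutes_in_image[OF cycle_permutes])
    then have "cycle_of_list (L i) x \<notin> set (L j)"
      using Cons.prems(1)[of j] False by auto
    ultimately show ?thesis by (simp only: step id_outside_supp simp_thms)
  qed
qed simp

lemma mult_add_less_mult: "k < l \<Longrightarrow> i < t \<Longrightarrow> i * l + k < t * (l :: nat)"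
proof -
  assume "k < l" "i < t"
  then have "i * l + k < Suc i * l" by simp
  also have "\<dots> \<le> t * l" using \<open>i < t\<close> by (intro mult_le_mono1) simp
  finally show ?thesis .
qed

lemma mult_add_eq_iff:
  assumes "k < l" "k' < l"
  shows "i * l + k = i' * l + k' \<longleftrightarrow> i = i' \<and> k = (k' :: nat)"
proof
  assume eq: "i * l + k = i' * l + k'"
  then have "(i * l + k) div l = (i' * l + k') div l" by simp
  then have "i = i'" using assms by simp
  with eq show "i = i' \<and> k = k'" by simp
qed simp

text \<open>An index below \<open>t * l\<close> has a low digit below \<open>l\<close> and a high
  digit below \<open>t\<close>. The permutation a advances the low digit cyclically; b, in the next
  lemma, advances the high digit.\<close>

lemma klenian_a_apply:
  assumes inj: "inj_on c {..<t * l}" and "i < t" "k < l"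
  shows "klenian_a c l t (c (i * l + k)) = c (i * l + Suc k mod l)"
proof -
  let ?L = "\<lambda>i. map (\<lambda>k. c (i * l + k)) [0..<l]"
  have eq_iff: "c (j * l + k) = c (j' * l + k') \<longleftrightarrow> j = j' \<and> k = k'"
    if "j < t" "k < l" "j' < t" "k' < l" for j k j' k'
    using inj_on_eq_iff[OF inj] mult_add_less_mult mult_add_eq_iff that by simp
  have "klenian_a c l t (c (i * l + k)) = cycle_of_list (?L i) (c (i * l + k))"
    unfolding klenian_a_def
    by (rule foldr_comp_disjoint_cycles) (use assms in \<open>auto simp: eq_iff\<close>)
  also have "distinct (?L i)"
    using assms(2) by (auto simp: distinct_map inj_on_def eq_iff)
  then have "cycle_of_list (?L i) (c (i * l + k)) = c (i * l + Suc k mod l)"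
    using cycle_of_list_nth[of "?L i" k] assms(3) by simp
  finally show ?thesis .
qed

lemma klenian_b_apply:
  assumes inj: "inj_on c {..<t * l}" and "j < l" "k < t"
  shows "klenian_b c l t (c (j + k * l)) = c (j + (Suc k mod t) * l)"
proof -
  let ?L = "\<lambda>j. map (\<lambda>k. c (j + k * l)) [0..<t]"
  have eq_iff: "c (j + k * l) = c (j' + k' * l) \<longleftrightarrow> j = j' \<and> k = k'"
    if "k < t" "j < l" "k' < t" "j' < l" for j k j' k'
    using inj_on_eq_iff[OF inj, of "k * l + j" "k' * l + j'"] mult_add_less_mult mult_add_eq_iff[of j l j' k k'] that
    by (auto simp: add.commute)
  have "klenian_b c l t (c (j + k * l)) = cycle_of_list (?L j) (c (j + k * l))"
    unfolding klenian_b_def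
    by (rule foldr_comp_disjoint_cycles) (use assms in \<open>auto simp: eq_iff\<close>)
  also have "distinct (?L j)"
    using assms(2) by (auto simp: distinct_map inj_on_def eq_iff)
  then have "cycle_of_list (?L j) (c (j + k * l)) = c (j + (Suc k mod t) * l)"
    using cycle_of_list_nth[of "?L j" k] assms(3) by simp
  finally show ?thesis .
qed

section \<open>The model group \<int>/l \<times> \<int>/t and its embedding as the Klenian
  group\<close>

abbreviation cyclic_prod :: "nat \<Rightarrow> nat \<Rightarrow> (int \<times> int) monoid" where
  "cyclic_prod l t \<equiv> integer_mod_group l \<times>\<times> integer_mod_group t"

lemma group_cyclic_prod: "group (cyclic_prod l t)"
  by (intro DirProd_group group_integer_mod_group)

lemma carrier_cyclic_prod:
  "l > 0 \<Longrightarrow> t > 0 \<Longrightarrow> carrier (cyclic_prod l t) = {0..<int l} \<times> {0..<int t}"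
  by (simp add: carrier_integer_mod_group)

lemma generate_cyclic_prod:
  assumes "l > 1" "t > 1"
  shows "generate (cyclic_prod l t) {(1, 0), (0, 1)} = carrier (cyclic_prod l t)"
proof -
  let ?G = "cyclic_prod l t"
  let ?H = "generate ?G {(1, 0), (0, 1)}"
  interpret group ?G by (rule group_cyclic_prod)
  have gens: "{(1, 0), (0, 1)} \<subseteq> carrier ?G"
    using assms by (simp add: carrier_integer_mod_group)
  interpret H: subgroup ?H ?G
    by (rule generate_is_subgroup[OF gens])
  \<comment> \<open>Reducing modulo \<open>l\<close> inside the claim lets the induction run over
    all \<open>k\<close> without a bound.\<close>
  have a: "(int k mod int l, 0) \<in> ?H" for k
  proof (induction k)
    case 0
    show ?case using H.one_closed by simp
  next
    case (Suc k)
    have "(1, 0) \<otimes>\<^bsub>?G\<^esub> (int k mod int l, 0) \<in> ?H"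
      by (rule H.m_closed[OF generate.incl Suc]) simp
    then show ?case by (simp add: mod_simps)
  qed
  have b: "(0, int k mod int t) \<in> ?H" for k
  proof (induction k)
    case 0
    show ?case using H.one_closed by simp
  next
    case (Suc k)
    have "(0, 1) \<otimes>\<^bsub>?G\<^esub> (0, int k mod int t) \<in> ?H"
      by (rule H.m_closed[OF generate.incl Suc]) simp
    then show ?case by (simp add: mod_simps)
  qed
  have "carrier ?G \<subseteq> ?H"
  proof
    fix g assume "g \<in> carrier ?G"
    then obtain u v where uv: "g = (u, v)" "0 \<le> u" "u < int l" "0 \<le> v" "v < int t"
      using assms carrier_cyclic_prod by fastforce
    have "(u, 0) \<otimes>\<^bsub>?G\<^esub> (0, v) \<in> ?H"
      using a[of "nat u"] b[of "nat v"] uv by (intro H.m_closed) auto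
    with uv show "g \<in> ?H" by simp
  qed
  then show ?thesis using H.subset by blast
qed

text \<open>The digit map \<open>\<sigma>\<close> sends (u, v) to c_{u + v l}. Along it, a and b
  become translation by (1, 0) and (0, 1), so the group they generate is the image of a regular
  representation of \<int>/l \<times> \<int>/t.\<close>

lemma klenian_group_iso:
  fixes c :: "nat \<Rightarrow> 'a::{field,finite}"
  assumes c: "bij_betw c {..<CARD('a)} UNIV"
    and card: "CARD('a) = t * p ^ e" and "p ^ e > 1" "t > 1"
  shows "cyclic_prod (p ^ e) t \<cong> (BijGroup UNIV)\<lparr>carrier := klenian_group c p e\<rparr>"
proof -
  define l where "l = p ^ e"
  let ?G = "cyclic_prod l t"
  have lt: "l > 1" "t > 1" using assms by (simp_all add: l_def)
  have inj: "inj_on c {..<t * l}"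
    using c card by (simp add: l_def bij_betw_def)
  interpret G: group ?G by (rule group_cyclic_prod)
  define \<sigma> where "\<sigma> = (\<lambda>(u, v). c (nat u + nat v * l))"
  have \<sigma>: "bij_betw \<sigma> (carrier ?G) UNIV"
  proof -
    have "inj_on \<sigma> (carrier ?G)"
    proof (rule inj_onI)
      fix g h assume gh: "g \<in> carrier ?G" "h \<in> carrier ?G" "\<sigma> g = \<sigma> h"
      obtain u v where g: "g = (u, v)" "0 \<le> u" "u < int l" "0 \<le> v" "v < int t"
        using gh(1) lt carrier_cyclic_prod[of l t] by fastforce
      obtain u' v' where h: "h = (u', v')" "0 \<le> u'" "u' < int l" "0 \<le> v'" "v' < int t"
        using gh(2) lt carrier_cyclic_prod[of l t] by fastforce
      have lt': "nat u < l" "nat u' < l" "nat v < t" "nat v' < t" using g h by auto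
      have "c (nat v * l + nat u) = c (nat v' * l + nat u')"
        using gh(3) g h by (simp add: \<sigma>_def add.commute)
      then have "nat v * l + nat u = nat v' * l + nat u'"
        using inj_on_eq_iff[OF inj] mult_add_less_mult lt' by simp
      then show "g = h"
        using lt' g h by (simp add: mult_add_eq_iff eq_nat_nat_iff)
    qed
    moreover have "card (carrier ?G) = card (UNIV :: 'a set)"
      using card lt by (subst carrier_cyclic_prod) (simp_all flip: l_def)
    ultimately have "\<sigma> ` carrier ?G = UNIV"
      by (intro card_subset_eq) (simp_all add: card_image)
    with \<open>inj_on \<sigma> _\<close> show ?thesis by (simp add: bij_betw_def)
  qed
  let ?\<rho> = "G.transported_rep \<sigma>"
  have \<rho>: "?\<rho> \<in> G.regular_reps" by (rule G.transported_rep_in_regular_reps[OF \<sigma>])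
  have gens: "{(1, 0), (0, 1)} \<subseteq> carrier ?G"
    using lt by (simp add: carrier_integer_mod_group)
  have nat_Suc_mod: "nat ((1 + x) mod int m) = Suc (nat x) mod m" if "0 \<le> x" for x m
    using that by (simp add: nat_mod_distrib nat_add_distrib)
  have a: "?\<rho> (1, 0) = klenian_a c l t" and b: "?\<rho> (0, 1) = klenian_b c l t"
  proof -
    have "?\<rho> (1, 0) x = klenian_a c l t x \<and> ?\<rho> (0, 1) x = klenian_b c l t x" for x
    proof -
      have "x \<in> \<sigma> ` carrier ?G" using \<sigma> by (simp add: bij_betw_def)
      then obtain g where g: "g \<in> carrier ?G" "x = \<sigma> g" by blast
      obtain u v where uv: "g = (u, v)" "0 \<le> u" "u < int l" "0 \<le> v" "v < int t"
        using g(1) lt carrier_cyclic_prod[of l t] by fastforce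
      have lt': "nat u < l" "nat v < t" using uv by auto
      have "?\<rho> (1, 0) x = \<sigma> ((1, 0) \<otimes>\<^bsub>?G\<^esub> g)" "?\<rho> (0, 1) x = \<sigma> ((0, 1) \<otimes>\<^bsub>?G\<^esub> g)"
        unfolding g(2) using G.transported_rep_apply[OF \<sigma> _ g(1)] gens by auto
      then have "?\<rho> (1, 0) x = c (nat v * l + Suc (nat u) mod l)"
        "?\<rho> (0, 1) x = c (nat u + (Suc (nat v) mod t) * l)"
        using uv by (auto simp: \<sigma>_def nat_Suc_mod add.commute)
      moreover have "x = c (nat v * l + nat u)" "x = c (nat u + nat v * l)"
        using g(2) uv(1) by (simp_all add: \<sigma>_def add.commute)
      ultimately show ?thesis
        using klenian_a_apply[OF inj lt'(2,1)] klenian_b_apply[OF inj lt'] by simp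
    qed
    then show "?\<rho> (1, 0) = klenian_a c l t" "?\<rho> (0, 1) = klenian_b c l t" by auto
  qed
  interpret gh: group_hom ?G "BijGroup (UNIV :: 'a set)" ?\<rho>
    using \<rho> group_BijGroup
    by (auto simp: G.regular_reps_def group_hom_def group_hom_axioms_def G.is_group)
  have "CARD('a) div l = t" using card lt by (simp flip: l_def)
  then have "klenian_group c p e = generate (BijGroup UNIV) (?\<rho> ` {(1, 0), (0, 1)})"
    by (simp add: klenian_group_def a b Let_def flip: l_def)
  also have "\<dots> = ?\<rho> ` carrier ?G"
    using gh.generate_img[OF gens] generate_cyclic_prod[OF lt] by simp
  finally show ?thesis
    using is_isoI[OF G.regular_rep_iso(3)[OF \<rho>]] by (simp add: l_def)
qed

section \<open>Automorphisms of a product of two cyclic groups\<close>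

text \<open>
  The endomorphism of \<open>\<int>/l \<times> \<int>/(l r)\<close> with \<open>(1, 0) \<mapsto> (x1, r z)\<close> and \<open>(0, 1) \<mapsto> (x2, y2)\<close>.
  The entry \<open>r z\<close> must be a multiple of \<open>r\<close> because \<open>(1, 0)\<close> is killed by \<open>l\<close>.
\<close>

definition cyclic_prod_endo :: "nat \<Rightarrow> nat \<Rightarrow> int \<times> int \<times> int \<times> int \<Rightarrow> int \<times> int \<Rightarrow> int \<times> int" where
  "cyclic_prod_endo l r = (\<lambda>(x1, z, x2, y2). \<lambda>(i, j)\<in>{0..<int l} \<times> {0..<int (l * r)}.
     ((i * x1 + j * x2) mod int l, (i * (int r * z) + j * y2) mod int (l * r)))"

text \<open>The matrix formula respects residue classes: changing \<open>i\<close> by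
  \<open>l\<close> changes \<open>i * (r * z)\<close> by a multiple of \<open>l * r\<close>, and
  \<open>j\<close> modulo \<open>l * r\<close> determines \<open>j\<close> modulo
  \<open>l\<close>.\<close>

lemma cyclic_prod_endo_mod:
  assumes "l > 0" "r > 0"
  shows "cyclic_prod_endo l r (x1, z, x2, y2) (i mod int l, j mod int (l * r)) =
    ((i * x1 + j * x2) mod int l, (i * (int r * z) + j * y2) mod int (l * r))"
proof -
  let ?L = "int l" and ?R = "int r"
  have 1: "[i mod ?L = i] (mod ?L)" "[j mod (?L * ?R) = j] (mod (?L * ?R))"
    by (auto simp: cong_def)
  then have 2: "[j mod (?L * ?R) = j] (mod ?L)"
    by (blast intro: cong_dvd_modulus dvd_triv_left)
  have 3: "[(i mod ?L) * ?R = i * ?R] (mod (?L * ?R))"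
    by (simp add: cong_def mod_mult_mult2 flip: mult_mod_left)
  have "[(i mod ?L) * ?R * z = i * ?R * z] (mod (?L * ?R))"
    using 3 by (rule cong_mult) simp
  then have "[(i mod ?L) * (?R * z) + (j mod (?L * ?R)) * y2 = i * (?R * z) + j * y2] (mod (?L * ?R))"
    using cong_mult[OF 1(2), of y2 y2] by (intro cong_add) (simp_all add: mult.assoc)
  moreover have "[(i mod ?L) * x1 + (j mod (?L * ?R)) * x2 = i * x1 + j * x2] (mod ?L)"
    using cong_mult[OF 1(1), of x1 x1] cong_mult[OF 2, of x2 x2] by (intro cong_add) simp_all
  moreover have "(i mod ?L, j mod (?L * ?R)) \<in> {0..<?L} \<times> {0..<?L * ?R}"
    using assms by simp
  ultimately show ?thesis
    by (simp add: cyclic_prod_endo_def cong_def)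
qed

lemma cyclic_prod_endo_hom:
  assumes "l > 0" "r > 0"
  shows "cyclic_prod_endo l r m \<in> hom (cyclic_prod l (l * r)) (cyclic_prod l (l * r))"
proof (rule homI)
  obtain x1 z x2 y2 where m: "m = (x1, z, x2, y2)" by (cases m) auto
  have car: "carrier (cyclic_prod l (l * r)) = {0..<int l} \<times> {0..<int (l * r)}"
    using assms by (simp add: carrier_integer_mod_group)
  fix g assume "g \<in> carrier (cyclic_prod l (l * r))"
  then obtain i j where g: "g = (i, j)" "i \<in> {0..<int l}" "j \<in> {0..<int (l * r)}"
    unfolding car by auto
  have eval: "cyclic_prod_endo l r m (i, j) =
      ((i * x1 + j * x2) mod int l, (i * (int r * z) + j * y2) mod int (l * r))"
    using g by (simp add: cyclic_prod_endo_def m)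
  then show "cyclic_prod_endo l r m g \<in> carrier (cyclic_prod l (l * r))"
    using assms unfolding car g(1) by simp
  fix h assume "h \<in> carrier (cyclic_prod l (l * r))"
  then obtain i' j' where h: "h = (i', j')" "i' \<in> {0..<int l}" "j' \<in> {0..<int (l * r)}"
    unfolding car by auto
  have eval': "cyclic_prod_endo l r m (i', j') =
      ((i' * x1 + j' * x2) mod int l, (i' * (int r * z) + j' * y2) mod int (l * r))"
    using h by (simp add: cyclic_prod_endo_def m)
  have "cyclic_prod_endo l r m ((i + i') mod int l, (j + j') mod int (l * r)) =
      (((i + i') * x1 + (j + j') * x2) mod int l, ((i + i') * (int r * z) + (j + j') * y2) mod int (l * r))"
    unfolding m by (rule cyclic_prod_endo_mod[OF assms])
  then show "cyclic_prod_endo l r m (g \<otimes>\<^bsub>cyclic_prod l (l * r)\<^esub> h) =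
      cyclic_prod_endo l r m g \<otimes>\<^bsub>cyclic_prod l (l * r)\<^esub> cyclic_prod_endo l r m h"
    unfolding g(1) h(1) by (simp add: eval[simplified] eval'[simplified] mod_add_eq algebra_simps)
qed

text \<open>\<open>?D\<close> is the determinant of the matrix. If it is prime to p, the adjugate
  recovers (i, j) from its image; if p divides it, the kernel already meets the elements of order
  p.\<close>

lemma inj_on_cyclic_prod_endo_iff:
  fixes p e r :: nat
  assumes p: "prime p" and e: "e > 0" and r: "r = p ^ k"
  defines "l \<equiv> p ^ e"
  shows "inj_on (cyclic_prod_endo l r (x1, z, x2, y2)) (carrier (cyclic_prod l (l * r))) \<longleftrightarrow>
    \<not> int p dvd x1 * y2 - int r * z * x2" (is "_ \<longleftrightarrow> \<not> _ dvd ?D")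
proof -
  let ?G = "cyclic_prod l (l * r)" and ?f = "cyclic_prod_endo l r (x1, z, x2, y2)"
  define L R P where "L = int l" and "R = int r" and "P = int p"
  have p0: "p > 0" using p by (simp add: prime_gt_0_nat)
  have pos: "l > 0" "r > 0" using p0 by (simp_all add: l_def r)
  have posI: "L > 0" "R > 0" using pos by (simp_all add: L_def R_def)
  interpret gh: group_hom ?G ?G ?f
    using group_cyclic_prod cyclic_prod_endo_hom[OF pos] by (auto simp: group_hom_def group_hom_axioms_def)
  have car: "carrier ?G = {0..<L} \<times> {0..<L * R}"
    using pos by (simp add: carrier_integer_mod_group L_def R_def)
  have f: "?f (i mod L, j mod (L * R)) = ((i * x1 + j * x2) mod L, (i * (R * z) + j * y2) mod (L * R))" for i j
    using cyclic_prod_endo_mod[OF pos] by (simp add: L_def R_def)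
  have inj_iff: "inj_on ?f (carrier ?G) \<longleftrightarrow> (\<forall>g\<in>carrier ?G. ?f g = (0, 0) \<longrightarrow> g = (0, 0))"
    using gh.inj_on_one_iff by auto
  show ?thesis
  proof
    assume inj: "inj_on ?f (carrier ?G)"
    show "\<not> int p dvd ?D"
    proof
      assume D: "int p dvd ?D"
      \<comment> \<open>With \<open>L'\<close> = l/p, the pairs (a L', b L' r) represent exactly the
        elements killed by p.\<close>
      define L' where "L' = int (p ^ (e - 1))"
      have L': "L = P * L'" "L' > 0"
        using e p0 by (simp_all add: L_def L'_def P_def l_def flip: power_Suc of_nat_mult)
      \<comment> \<open>On these elements the map acts as the matrix with rows (x1, r x2) and (z,
        y2) modulo p, again of determinant \<open>?D\<close>. Injectivity says that its kernel
        modulo p is trivial.\<close>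
      have ker: "P dvd a \<and> P dvd b"
        if ab: "P dvd a * x1 + b * R * x2" "P dvd a * z + b * y2" for a b
      proof -
        let ?i = "a * L'" and ?j = "b * (L' * R)"
        have "?f (?i mod L, ?j mod (L * R)) = ((?i * x1 + ?j * x2) mod L, (?i * (R * z) + ?j * y2) mod (L * R))"
          by (rule f)
        also have "?i * x1 + ?j * x2 = L' * (a * x1 + b * R * x2)" by (simp add: algebra_simps)
        also have "?i * (R * z) + ?j * y2 = L' * R * (a * z + b * y2)" by (simp add: algebra_simps)
        also have "L' * (a * x1 + b * R * x2) mod L = 0"
          using mult_dvd_mono[OF dvd_refl[of L'] ab(1)] by (simp add: L'(1) mult.commute mod_eq_0_iff_dvd)
        also have "L' * R * (a * z + b * y2) mod (L * R) = 0"
          using mult_dvd_mono[OF dvd_refl[of "L' * R"] ab(2)] by (simp add: L'(1) ac_simps mod_eq_0_iff_dvd)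
        finally have "?f (?i mod L, ?j mod (L * R)) = (0, 0)" .
        moreover have "(?i mod L, ?j mod (L * R)) \<in> carrier ?G"
          using posI unfolding car by simp
        ultimately have "(?i mod L, ?j mod (L * R)) = (0, 0)"
          using inj inj_iff by blast
        then have "P * L' dvd a * L'" "P * (L' * R) dvd b * (L' * R)"
          by (simp_all add: L'(1) mod_eq_0_iff_dvd ac_simps)
        then show ?thesis
          using L'(2) posI by simp
      qed
      \<comment> \<open>The columns of the adjugate, (-r x2, x1) and (y2, -z), are mapped to
        multiples of \<open>?D\<close>, so they vanish modulo p. Then the whole matrix vanishes
        modulo p, and (1, 0) is a nontrivial kernel vector.\<close>
      have "P dvd x1"
        using ker[of "- R * x2" x1] D by (simp add: P_def R_def algebra_simps)
      moreover have "P dvd - R * x2"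
        using ker[of "- R * x2" x1] D by (simp add: P_def R_def algebra_simps)
      moreover have "P dvd z" "P dvd y2"
        using ker[of y2 "- z"] D by (simp_all add: P_def R_def algebra_simps)
      ultimately have "P dvd 1"
        using ker[of 1 0] by simp
      then show False using p by (simp add: P_def prime_gt_1_nat)
    qed
  next
    assume D: "\<not> int p dvd ?D"
    then have "coprime P ?D"
      using p by (simp add: P_def prime_imp_coprime)
    then have cop: "coprime L ?D" "coprime (L * R) ?D"
      by (simp_all add: L_def l_def R_def r P_def)
    show "inj_on ?f (carrier ?G)"
      unfolding inj_iff
    proof (intro ballI impI)
      fix g assume g: "g \<in> carrier ?G" "?f g = (0, 0)"
      obtain i j where ij: "g = (i, j)" "0 \<le> i" "i < L" "0 \<le> j" "j < L * R"
        using g(1) unfolding car by auto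
      have "((i * x1 + j * x2) mod L, (i * (R * z) + j * y2) mod (L * R)) = (0, 0)"
        using f[of i j] g(2) ij by simp
      then have 1: "L dvd i * x1 + j * x2" and 2: "L * R dvd i * (R * z) + j * y2"
        by (simp_all add: mod_eq_0_iff_dvd)
      have 3: "L dvd i * (R * z) + j * y2" by (rule dvd_mult_left[OF 2])
      \<comment> \<open>Multiplying by the adjugate eliminates \<open>j\<close> here and
        \<open>i\<close> below. For the latter, the first relation is scaled by r so that it holds
        modulo \<open>L * R\<close>.\<close>
      have "L dvd y2 * (i * x1 + j * x2) - x2 * (i * (R * z) + j * y2)"
        using 1 3 by (intro dvd_diff dvd_mult)
      also have "\<dots> = i * ?D" by (simp add: R_def algebra_simps)
      finally have "L dvd i" using cop(1) by (simp add: coprime_dvd_mult_left_iff)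
      then have "i = 0" using ij zdvd_not_zless by force
      have "L * R dvd x1 * (i * (R * z) + j * y2) - z * ((i * x1 + j * x2) * R)"
        using 1 2 by (intro dvd_diff dvd_mult mult_dvd_mono) auto
      also have "\<dots> = j * ?D" by (simp add: R_def algebra_simps)
      finally have "L * R dvd j" using cop(2) by (simp add: coprime_dvd_mult_left_iff)
      then have "j = 0" using ij zdvd_not_zless by force
      with \<open>i = 0\<close> ij show "g = (0, 0)" by simp
    qed
  qed
qed

text \<open>Entries are reduced so that each endomorphism has one matrix; \<open>z\<close> runs only
  up to \<open>l\<close> because it enters through \<open>r * z\<close> modulo
  \<open>l * r\<close>.\<close>

definition unit_matrices :: "nat \<Rightarrow> nat \<Rightarrow> nat \<Rightarrow> (int \<times> int \<times> int \<times> int) set" where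
  "unit_matrices p l r = {(x1, z, x2, y2). x1 \<in> {0..<int l} \<and> z \<in> {0..<int l} \<and> x2 \<in> {0..<int l} \<and>
     y2 \<in> {0..<int (l * r)} \<and> \<not> int p dvd x1 * y2 - int r * z * x2}"

text \<open>An endomorphism is determined by the images of (1, 0) and (0, 1), which are the rows of
  its matrix. On a finite group injectivity suffices for an automorphism, so the determinant
  criterion applies.\<close>

lemma bij_betw_cyclic_prod_endo:
  fixes p e r :: nat
  assumes p: "prime p" and e: "e > 0" and r: "r = p ^ k"
  defines "l \<equiv> p ^ e"
  shows "bij_betw (cyclic_prod_endo l r) (unit_matrices p l r) (auto (cyclic_prod l (l * r)))"
proof (rule bij_betw_imageI)
  let ?G = "cyclic_prod l (l * r)"
  have p1: "p > 1" using p by (rule prime_gt_1_nat)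
  have pos: "l > 1" "r > 0" using p1 one_less_power[OF p1 e] by (simp_all add: l_def r)
  then have pos': "l > 0" "l * r > 1" using less_le_trans[of 1 l "l * r"] by simp_all
  define L T where "L = int l" and "T = int (l * r)"
  have LT: "L > 1" "T > 1" using pos pos' by (simp_all add: L_def T_def del: of_nat_mult)
  have car: "carrier ?G = {0..<L} \<times> {0..<T}"
    using pos pos' by (simp add: carrier_integer_mod_group L_def T_def)
  have at_gens: "cyclic_prod_endo l r (x1, z, x2, y2) (1, 0) = (x1 mod L, int r * z mod T)"
    "cyclic_prod_endo l r (x1, z, x2, y2) (0, 1) = (x2 mod L, y2 mod T)" for x1 z x2 y2
    using LT unfolding cyclic_prod_endo_def L_def[symmetric] T_def[symmetric] by simp_all
  show "inj_on (cyclic_prod_endo l r) (unit_matrices p l r)"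
  proof (rule inj_onI)
    fix m m' assume mm: "m \<in> unit_matrices p l r" "m' \<in> unit_matrices p l r"
      "cyclic_prod_endo l r m = cyclic_prod_endo l r m'"
    obtain x1 z x2 y2 where m: "m = (x1, z, x2, y2)" by (cases m) auto
    obtain x1' z' x2' y2' where m': "m' = (x1', z', x2', y2')" by (cases m') auto
    have zmod: "int r * z mod T = int r * z" if "z \<in> {0..<int l}" for z
      using that pos by (intro mod_pos_pos_trivial) (auto simp: T_def mult.commute)
    have "(x1 mod L, int r * z mod T) = (x1' mod L, int r * z' mod T)"
      "(x2 mod L, y2 mod T) = (x2' mod L, y2' mod T)"
      using fun_cong[OF mm(3), of "(1, 0)"] fun_cong[OF mm(3), of "(0, 1)"]
      unfolding m m' at_gens by simp_all
    then show "m = m'"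
      using mm(1,2) zmod[of z] zmod[of z'] pos
      unfolding m m' unit_matrices_def by (simp add: L_def T_def)
  qed
  show "cyclic_prod_endo l r ` unit_matrices p l r = auto ?G"
  proof (intro equalityI subsetI)
    fix \<theta> assume "\<theta> \<in> cyclic_prod_endo l r ` unit_matrices p l r"
    then obtain x1 z x2 y2 where m: "(x1, z, x2, y2) \<in> unit_matrices p l r"
      "\<theta> = cyclic_prod_endo l r (x1, z, x2, y2)" by auto
    have hom: "\<theta> \<in> hom ?G ?G" unfolding m(2) using pos by (intro cyclic_prod_endo_hom) auto
    have "inj_on \<theta> (carrier ?G)"
      using inj_on_cyclic_prod_endo_iff[OF p e r] m by (simp add: unit_matrices_def l_def)
    moreover have "\<theta> ` carrier ?G \<subseteq> carrier ?G" by (rule hom_carrier[OF hom])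
    moreover have "finite (carrier ?G)" unfolding car by simp
    ultimately have "bij_betw \<theta> (carrier ?G) (carrier ?G)"
      by (simp add: bij_betw_def endo_inj_surj)
    moreover have "\<theta> \<in> extensional (carrier ?G)"
      unfolding car m(2) cyclic_prod_endo_def L_def T_def by simp
    ultimately show "\<theta> \<in> auto ?G"
      using hom by (simp add: auto_def Bij_def)
  next
    fix \<theta> assume \<theta>: "\<theta> \<in> auto ?G"
    then have hom: "\<theta> \<in> hom ?G ?G" and bij: "bij_betw \<theta> (carrier ?G) (carrier ?G)"
      and ext: "\<theta> \<in> extensional (carrier ?G)"
      by (simp_all add: auto_def Bij_def)
    interpret gh: group_hom ?G ?G \<theta>
      using group_cyclic_prod hom by (auto simp: group_hom_def group_hom_axioms_def)
    have gens: "(1, 0) \<in> carrier ?G" "(0, 1) \<in> carrier ?G" using LT unfolding car by auto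
    obtain x1 y1 where xy1: "\<theta> (1, 0) = (x1, y1)" "x1 \<in> {0..<L}" "y1 \<in> {0..<T}"
      using gh.hom_closed[OF gens(1)] unfolding car by (cases "\<theta> (1, 0)") auto
    obtain x2 y2 where xy2: "\<theta> (0, 1) = (x2, y2)" "x2 \<in> {0..<L}" "y2 \<in> {0..<T}"
      using gh.hom_closed[OF gens(2)] unfolding car by (cases "\<theta> (0, 1)") auto
    have \<theta>1: "\<theta> (int k mod L, 0) = (int k * x1 mod L, int k * y1 mod T)" for k
    proof (induction k)
      case 0
      show ?case using gh.hom_one by simp
    next
      case (Suc k)
      have "(int k mod L, 0) \<in> carrier ?G" using LT unfolding car by simp
      from gh.hom_mult[OF gens(1) this] show ?case
        by (simp add: Suc xy1 mod_simps algebra_simps del: of_nat_mult flip: L_def T_def)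
    qed
    have \<theta>2: "\<theta> (0, int k mod T) = (int k * x2 mod L, int k * y2 mod T)" for k
    proof (induction k)
      case 0
      show ?case using gh.hom_one by simp
    next
      case (Suc k)
      have "(0, int k mod T) \<in> carrier ?G" using LT unfolding car by simp
      from gh.hom_mult[OF gens(2) this] show ?case
        by (simp add: Suc xy2 mod_simps algebra_simps del: of_nat_mult flip: L_def T_def)
    qed
    \<comment> \<open>Since (1, 0) is killed by \<open>l\<close>, so is its image: l r divides l y1,
      hence r divides y1. This produces the entry \<open>z\<close>.\<close>
    have "T dvd L * y1"
      using \<theta>1[of l] \<theta>1[of 0] by (simp add: mod_eq_0_iff_dvd flip: L_def)
    then have "int r dvd y1"
      using LT by (simp add: T_def L_def)
    then obtain z where z: "y1 = int r * z" by blast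
    have z_range: "z \<in> {0..<int l}"
    proof -
      have "0 \<le> int r * z" "int r * z < int r * int l"
        using xy1(3) unfolding z T_def by (simp_all add: mult.commute)
      then show ?thesis using pos by (simp add: zero_le_mult_iff)
    qed
    have eq: "\<theta> = cyclic_prod_endo l r (x1, z, x2, y2)"
    proof (rule extensionalityI[OF ext])
      show "cyclic_prod_endo l r (x1, z, x2, y2) \<in> extensional (carrier ?G)"
        unfolding car cyclic_prod_endo_def L_def T_def by simp
      fix g assume "g \<in> carrier ?G"
      then obtain i j where ij: "g = (i, j)" "0 \<le> i" "i < L" "0 \<le> j" "j < T"
        unfolding car by auto
      have "(i, 0) \<in> carrier ?G" "(0, j) \<in> carrier ?G" using ij LT unfolding car by simp_all
      from gh.hom_mult[OF this] have "\<theta> (i, j) = \<theta> (i, 0) \<otimes>\<^bsub>?G\<^esub> \<theta> (0, j)"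
        using ij by (simp del: of_nat_mult flip: L_def T_def)
      also have "\<theta> (i, 0) = (i * x1 mod L, i * y1 mod T)"
        using \<theta>1[of "nat i"] ij by simp
      also have "\<theta> (0, j) = (j * x2 mod L, j * y2 mod T)"
        using \<theta>2[of "nat j"] ij by simp
      finally have "\<theta> (i, j) = ((i * x1 + j * x2) mod L, (i * y1 + j * y2) mod T)"
        by (simp add: mod_simps del: of_nat_mult flip: L_def T_def)
      then show "\<theta> g = cyclic_prod_endo l r (x1, z, x2, y2) g"
        using ij by (simp add: cyclic_prod_endo_def z L_def T_def)
    qed
    have "inj_on \<theta> (carrier ?G)" using bij by (simp add: bij_betw_def)
    then have "\<not> int p dvd x1 * y2 - int r * z * x2"
      using inj_on_cyclic_prod_endo_iff[OF p e r, of x1 z x2 y2] by (simp add: eq l_def)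
    then have "(x1, z, x2, y2) \<in> unit_matrices p l r"
      using xy1 xy2 z_range by (simp add: unit_matrices_def L_def T_def)
    with eq show "\<theta> \<in> cyclic_prod_endo l r ` unit_matrices p l r" by blast
  qed
qed

section \<open>Counting invertible matrices\<close>

text \<open>Being prime to p^e means not being divisible by p. Residues start at 0 whereas
  \<open>totatives\<close> runs from 1 to p^e; both extra endpoints are multiples of p.\<close>

lemma card_nonmultiples:
  assumes p: "prime p" and e: "e > 0"
  shows "card {x \<in> {0..<int (p ^ e)}. \<not> int p dvd x} = totient (p ^ e)"
proof -
  have gt1: "p ^ e > 1"
    using one_less_power[OF prime_gt_1_nat[OF p] e] .
  have cop: "coprime k (p ^ e) \<longleftrightarrow> \<not> p dvd k" for k
    using p e by (auto simp: coprime_power_right_iff coprime_commute[of k p] prime_imp_coprime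
        coprime_absorb_left)
  have "{x \<in> {0..<int (p ^ e)}. \<not> int p dvd x} = int ` totatives (p ^ e)"
  proof (intro equalityI subsetI)
    fix x assume x: "x \<in> {x \<in> {0..<int (p ^ e)}. \<not> int p dvd x}"
    then have "x \<noteq> 0" by auto
    moreover have "\<not> p dvd nat x"
      using x int_dvd_int_iff[of p "nat x"] by simp
    then have "coprime (nat x) (p ^ e)"
      by (simp only: cop not_False_eq_True)
    ultimately have "nat x \<in> totatives (p ^ e)"
      using x by (simp add: in_totatives_iff nat_le_iff del: coprime_power_right_iff)
    then show "x \<in> int ` totatives (p ^ e)"
      using x by (intro image_eqI[of _ _ "nat x"]) auto
  next
    fix x assume "x \<in> int ` totatives (p ^ e)"
    then obtain k where k: "x = int k" "k \<in> totatives (p ^ e)" by blast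
    then have "k < p ^ e" using totatives_less gt1 by blast
    moreover have "\<not> p dvd k"
      using k(2) cop by (simp add: in_totatives_iff del: coprime_power_right_iff)
    ultimately show "x \<in> {x \<in> {0..<int (p ^ e)}. \<not> int p dvd x}"
      by (simp add: k(1) del: of_nat_power)
  qed
  then show ?thesis by (simp add: card_image totient_def)
qed

text \<open>As \<open>x\<close> is a unit modulo p^e, y \<mapsto> x y - w permutes the residues, and
  reduction modulo p^e does not affect divisibility by p.\<close>

lemma card_nonmultiples_affine:
  assumes p: "prime p" and e: "e > 0" and x: "\<not> int p dvd x"
  shows "card {y \<in> {0..<int (p ^ e)}. \<not> int p dvd x * y - w} = totient (p ^ e)"
proof -
  define L where "L = int (p ^ e)"
  have L: "L > 0" using p by (simp add: L_def prime_gt_0_nat)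
  have pL: "int p dvd L" using e by (simp add: L_def)
  have "coprime L x"
    using p x by (simp add: L_def prime_imp_coprime)
  let ?g = "\<lambda>y. (x * y - w) mod L"
  have "inj_on ?g {0..<L}"
  proof (rule inj_onI)
    fix y y' assume y: "y \<in> {0..<L}" "y' \<in> {0..<L}" "?g y = ?g y'"
    then have "L dvd (x * y - w) - (x * y' - w)"
      by (simp only: mod_eq_dvd_iff)
    also have "\<dots> = (y - y') * x" by (simp add: algebra_simps)
    finally have "L dvd y - y'"
      using \<open>coprime L x\<close> by (simp add: coprime_dvd_mult_left_iff)
    then have "y mod L = y' mod L" by (simp add: mod_eq_dvd_iff)
    with y show "y = y'" by simp
  qed
  moreover have "?g ` {0..<L} \<subseteq> {0..<L}" using L by auto
  ultimately have img: "?g ` {0..<L} = {0..<L}" by (intro endo_inj_surj) auto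
  have dvd: "int p dvd ?g y \<longleftrightarrow> int p dvd x * y - w" for y
    using pL by (simp add: dvd_mod_iff)
  have "bij_betw ?g {y \<in> {0..<L}. \<not> int p dvd x * y - w} {y \<in> {0..<L}. \<not> int p dvd y}"
  proof (rule bij_betw_imageI)
    show "inj_on ?g {y \<in> {0..<L}. \<not> int p dvd x * y - w}"
      using \<open>inj_on ?g {0..<L}\<close> by (rule inj_on_subset) auto
    show "?g ` {y \<in> {0..<L}. \<not> int p dvd x * y - w} = {y \<in> {0..<L}. \<not> int p dvd y}"
    proof (intro equalityI subsetI)
      fix y assume y: "y \<in> {y \<in> {0..<L}. \<not> int p dvd y}"
      then have "y \<in> ?g ` {0..<L}" using img by simp
      with y show "y \<in> ?g ` {y \<in> {0..<L}. \<not> int p dvd x * y - w}"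
        using dvd by blast
    next
      fix y assume "y \<in> ?g ` {y \<in> {0..<L}. \<not> int p dvd x * y - w}"
      then obtain y' where "y = ?g y'" "\<not> int p dvd x * y' - w" by blast
      with L dvd[of y'] show "y \<in> {y \<in> {0..<L}. \<not> int p dvd y}" by simp
    qed
  qed
  from bij_betw_same_card[OF this] show ?thesis
    using card_nonmultiples[OF p e] by (simp add: L_def)
qed

text \<open>For k > 0 the determinant is x1 y2 modulo p: \<open>x1\<close> and \<open>y2\<close>
  must be non-multiples of p, while \<open>z\<close> and \<open>x2\<close> are free.\<close>

lemma card_unit_matrices:
  assumes p: "prime p" and e: "e > 0" and k: "k > 0"
  shows "card (unit_matrices p (p ^ e) (p ^ k)) = p ^ (2 * e) * totient (p ^ e) * totient (p ^ (e + k))"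
proof -
  let ?I = "{0..<int (p ^ e)}" and ?U = "\<lambda>m. {x \<in> {0..<int (p ^ m)}. \<not> int p dvd x}"
  have P: "prime (int p)" using p by simp
  have "int p dvd x1 * y2 - int (p ^ k) * z * x2 \<longleftrightarrow> int p dvd x1 \<or> int p dvd y2" for x1 y2 z x2
  proof -
    have "int p dvd int (p ^ k) * z * x2" using k by simp
    then show ?thesis
      using prime_dvd_mult_iff[OF P, of x1 y2] by (simp only: dvd_diff_left_iff)
  qed
  then have "unit_matrices p (p ^ e) (p ^ k) = ?U e \<times> ?I \<times> ?I \<times> ?U (e + k)"
    by (auto simp: unit_matrices_def power_add)
  moreover have "card (?U e \<times> ?I \<times> ?I \<times> ?U (e + k)) =
      card (?U e) * (card ?I * (card ?I * card (?U (e + k))))"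
    by (simp only: card_cartesian_product)
  ultimately show ?thesis
    using card_nonmultiples[OF p e] card_nonmultiples[OF p, of "e + k"] e
    by (simp add: power_mult power2_eq_square power_mult_distrib nat_power_eq mult_2 power_add)
qed

text \<open>Split by whether p divides \<open>x1\<close>. If not, \<open>y2\<close> satisfies an
  affine condition for any \<open>z\<close> and \<open>x2\<close>, giving \<phi> l^2 \<phi> matrices
  (\<open>?A\<close>). If so, \<open>z\<close> and \<open>x2\<close> must be non-multiples and
  \<open>y2\<close> is free, giving p^(e-1) \<phi>^2 l (\<open>?B\<close>).\<close>

lemma card_unit_matrices_square:
  assumes p: "prime p" and e: "e > 0"
  shows "card (unit_matrices p (p ^ e) 1) = totient (p ^ e) ^ 2 * (p ^ (2 * e) + p ^ (2 * e - 1))"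
proof -
  define L where "L = int (p ^ e)"
  define \<phi> where "\<phi> = totient (p ^ e)"
  let ?I = "{0..<L}" and ?U = "{x \<in> {0..<L}. \<not> int p dvd x}"
  let ?V = "{x \<in> {0..<L}. int p dvd x}"
  have P: "prime (int p)" using p by simp
  have U: "card ?U = \<phi>" using card_nonmultiples[OF p e] by (simp add: L_def \<phi>_def)
  have I: "card ?I = p ^ e" by (simp only: L_def card_atLeastLessThan_int diff_zero nat_int)
  have V: "card ?V = p ^ (e - 1)"
  proof -
    have "?V = (\<lambda>y. int p * y) ` {0..<int (p ^ (e - 1))}"
    proof -
      have L: "L = int p * int (p ^ (e - 1))"
        using e by (simp add: L_def flip: power_Suc of_nat_mult)
      have p0: "int p > 0" using p by (simp add: prime_gt_0_nat)
      show ?thesis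
        unfolding L using p0 by (auto simp: zero_le_mult_iff)
    qed
    then show ?thesis using p by (simp add: card_image inj_on_def nat_power_eq)
  qed
  have fin: "finite ?U" "finite ?V" by (rule finite_subset[of _ ?I]; auto)+
  define S where "S x1 z x2 = {y \<in> ?I. \<not> int p dvd x1 * y - z * x2}" for x1 z x2
  have fin_S: "finite (S x1 z x2)" for x1 z x2
    unfolding S_def by (rule finite_subset[of _ ?I]) auto
  have card_S: "card (S x1 z x2) = \<phi>" if "\<not> int p dvd x1" for x1 z x2
    using card_nonmultiples_affine[OF p e that] by (simp only: S_def L_def \<phi>_def)
  let ?A = "SIGMA x1:?U. SIGMA z:?I. SIGMA x2:?I. S x1 z x2"
  let ?B = "?V \<times> ?U \<times> ?U \<times> ?I"
  have "unit_matrices p (p ^ e) 1 = ?A \<union> ?B"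
  proof -
    have "int p dvd x1 * y2 - z * x2 \<longleftrightarrow> int p dvd z \<or> int p dvd x2" if "int p dvd x1" for x1 y2 z x2
    proof -
      have "int p dvd x1 * y2" using that by simp
      then show ?thesis
        using prime_dvd_mult_iff[OF P, of z x2] by (simp only: dvd_diff_right_iff)
    qed
    then show ?thesis by (auto simp: unit_matrices_def S_def L_def)
  qed
  moreover have "card ?A = \<phi> * p ^ e * p ^ e * \<phi>"
  proof -
    have "card (SIGMA x2:?I. S x1 z x2) = p ^ e * \<phi>" if "\<not> int p dvd x1" for x1 z
      using that I by (simp add: fin_S card_S)
    then have "card (SIGMA z:?I. SIGMA x2:?I. S x1 z x2) = p ^ e * (p ^ e * \<phi>)"
      if "\<not> int p dvd x1" for x1
      using that I by (simp add: fin_S)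
    then show ?thesis
      using U fin by (simp add: fin_S)
  qed
  moreover have "card ?B = p ^ (e - 1) * \<phi> * \<phi> * p ^ e"
    using U V I by (simp add: card_cartesian_product)
  moreover have "card (?A \<union> ?B) = card ?A + card ?B"
    using fin fin_S by (intro card_Un_disjoint finite_SigmaI finite_cartesian_product) auto
  moreover have "p ^ (2 * e - 1) = p ^ (e - 1) * p ^ e"
    using e by (simp add: mult_2 flip: power_add)
  moreover have "p ^ (2 * e) = p ^ e * p ^ e"
    by (simp add: mult_2 power_add)
  ultimately show ?thesis
    by (simp add: \<phi>_def power2_eq_square algebra_simps)
qed

section \<open>Assembling the count\<close>

lemma card_klenian_polys:
  fixes c :: "nat \<Rightarrow> 'a::{field,finite}"
  assumes p: "prime p" and card: "CARD('a) = p ^ n" and c: "bij_betw c {..<p ^ n} UNIV"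
    and e: "1 \<le> e" "2 * e \<le> n"
  shows "card {f. klenian_poly c p e f} * card (unit_matrices p (p ^ e) (p ^ (n - 2 * e))) =
    fact (p ^ n) * fact (p ^ n - 1)"
proof -
  define l r where "l = p ^ e" and "r = p ^ (n - 2 * e)"
  let ?G = "cyclic_prod l (l * r)"
  interpret G: group ?G by (rule group_cyclic_prod)
  \<comment> \<open>This is where e \<le> n/2 enters: the second cyclic factor has order p^(n-e) = l
    r, a multiple of l, as the matrix description requires.\<close>
  have pn: "p ^ n = l * r * p ^ e"
    using e(2) by (simp add: l_def r_def flip: power_add)
  have l1: "l > 1" using one_less_power[OF prime_gt_1_nat[OF p], of e] e(1) by (simp add: l_def)
  have r0: "r > 0" using p by (simp add: r_def prime_gt_0_nat)
  have lr: "l * r > 1" using l1 r0 less_le_trans[of 1 l "l * r"] by simp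
  have c': "bij_betw c {..<CARD('a)} UNIV" using c card by simp
  have kl: "?G \<cong> (BijGroup UNIV)\<lparr>carrier := klenian_group c p e\<rparr>"
    using klenian_group_iso[OF c', of "l * r" p e] card pn l1 lr by (simp add: l_def)
  let ?\<K> = "{K :: ('a \<Rightarrow> 'a) set. K \<in> regular_subgroups \<and> (BijGroup UNIV)\<lparr>carrier := K\<rparr> \<cong> ?G}"
  \<comment> \<open>Sharp transitivity holds for every associated set, so it can be added to the
    condition on the subgroup.\<close>
  have "klenian_poly c p e f \<longleftrightarrow> local_permutation_poly f \<and> associated_set c f \<in> ?\<K>" for f
    using sharply_transitive_associated_set[OF c'] iso_trans[OF _ kl] iso_trans[OF _ G.iso_sym[OF kl]]
    unfolding klenian_poly_def permutation_group_poly_def by blast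
  moreover have "bij k" if "K \<in> ?\<K>" "k \<in> K" for K k
    using that subgroup.subset[of K "BijGroup UNIV"] by (auto simp: carrier_BijGroup_UNIV)
  then have "card {f. local_permutation_poly f \<and> associated_set c f \<in> ?\<K>} = fact CARD('a) * card ?\<K>"
    by (intro card_local_permutation_polys[OF c']) simp_all
  ultimately have "card {f. klenian_poly c p e f} = fact (p ^ n) * card ?\<K>"
    by (simp only: card)
  moreover have card_G: "card (carrier ?G) = CARD('a)"
    using card pn l1 r0 by (subst carrier_cyclic_prod) (simp_all add: nat_mult_distrib mult.commute flip: l_def)
  have "card ?\<K> * card (auto ?G) = fact (p ^ n - 1)"
    using G.card_regular_subgroups_iso[OF card_G] card by simp
  moreover have "card (unit_matrices p l r) = card (auto ?G)"
    using bij_betw_cyclic_prod_endo[OF p _ r_def, of e] e(1) by (auto simp: l_def dest: bij_betw_same_card)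
  ultimately show ?thesis by (simp add: l_def r_def mult.assoc)
qed

theorem theorem4p11:
  fixes c :: "nat \<Rightarrow> 'a::{field,finite}" and p n e :: nat
  assumes "prime p" and "n \<ge> 2" and "CARD('a) = p ^ n"
    and "bij_betw c {..<p ^ n} UNIV"
    and "1 \<le> e" and "e \<le> n div 2"
  shows "(real e < real n / 2 \<longrightarrow>
            real (card {f. klenian_poly c p e f}) =
              fact (p ^ n) * fact (p ^ n - 1) /
                (real p ^ (2 * e) * real (totient (p ^ e)) * real (totient (p ^ (n - e)))))
       \<and> (real e = real n / 2 \<and> even n \<longrightarrow>
            real (card {f. klenian_poly c p e f}) =
              fact (p ^ n) * fact (p ^ n - 1) /
                (real (totient (p ^ e)) ^ 2 * (real p ^ (2 * e) + real p ^ (2 * e - 1))))"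
proof -
  have p0: "p > 0" using assms(1) by (rule prime_gt_0_nat)
  have e: "e > 0" "2 * e \<le> n" using assms by auto
  have "card {f. klenian_poly c p e f} * card (unit_matrices p (p ^ e) (p ^ (n - 2 * e))) =
      fact (p ^ n) * fact (p ^ n - 1)"
    using assms by (intro card_klenian_polys) auto
  then have count: "real (card {f. klenian_poly c p e f}) *
      real (card (unit_matrices p (p ^ e) (p ^ (n - 2 * e)))) = fact (p ^ n) * fact (p ^ n - 1)"
    by (metis of_nat_fact of_nat_mult)
  show ?thesis
  proof (intro conjI impI)
    assume "real e < real n / 2"
    \<comment> \<open>Here r is a proper power of p, so the determinant is x1 y2 modulo p.\<close>
    then have "n - 2 * e > 0" "e + (n - 2 * e) = n - e" using e by auto
    then have "card (unit_matrices p (p ^ e) (p ^ (n - 2 * e))) =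
        p ^ (2 * e) * totient (p ^ e) * totient (p ^ (n - e))"
      using card_unit_matrices[OF assms(1) e(1)] by simp
    then show "real (card {f. klenian_poly c p e f}) =
        fact (p ^ n) * fact (p ^ n - 1) /
          (real p ^ (2 * e) * real (totient (p ^ e)) * real (totient (p ^ (n - e))))"
      using count p0 by (simp add: eq_divide_eq)
  next
    assume "real e = real n / 2 \<and> even n"
    \<comment> \<open>Here r = 1, both cyclic factors have order p^e, and all four entries enter the
      determinant modulo p.\<close>
    then have "n - 2 * e = 0" by simp
    then have "card (unit_matrices p (p ^ e) (p ^ (n - 2 * e))) =
        totient (p ^ e) ^ 2 * (p ^ (2 * e) + p ^ (2 * e - 1))"
      using card_unit_matrices_square[OF assms(1) e(1)] by simp
    moreover have "real p ^ (2 * e) + real p ^ (2 * e - 1) > 0"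
      using p0 by (intro add_pos_pos) auto
    ultimately show "real (card {f. klenian_poly c p e f}) =
        fact (p ^ n) * fact (p ^ n - 1) /
          (real (totient (p ^ e)) ^ 2 * (real p ^ (2 * e) + real p ^ (2 * e - 1)))"
      using count p0 by (simp add: eq_divide_eq)
  qed
qed

end
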